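(* Let $CP_3(n)$ be defined by $\sum_{n\ge 0} CP_3(n)q^n = \dfrac{f_3^6f_6^6}{f_1^2f_2^2}$. Then for all integers $n\ge 0$, \[ CP_3(24n+15)\equiv 0\pmod{16},\qquad CP_3(24n+21)\equiv 0\pmod{16}. \]
   Context: For $|q|<1$ and integer $m\ge 1$, $f_m := (q^m;q^m)_\infty=\prod_{n\ge1}(1-q^{mn})$. $CP_3(n)$ is the number of $3$-core cubic bipartitions of $n$, defined by the generating function $\sum_{n\ge0}CP_3(n)q^n = \frac{f_3^6f_6^6}{f_1^2f_2^2}$. *)

theory Defs
  imports "HOL-Analysis.Analysis" "HOL-Number_Theory.Cong"
begin

(* f_m = (q^m; q^m)_infinity for m >= 1, as a formal power series over the integers with q the
   indeterminate fps_X.  The infinite product converges in the library's (X-adic) metric, see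
   euler_f_has_prod.  The index of prodinf starts at 0, whence Suc n. *)

definition euler_f :: "nat \<Rightarrow> int fps" where
  "euler_f m = (\<Prod>n. 1 - fps_X ^ (m * Suc n))"

(* Type int has no inverse operation, so (/) is not available on int fps.  The denominator has
   constant coefficient 1, and fps_right_inverse g 1 is then its reciprocal; the defining
   quotient is recovered in cp3_gf_mult and cp3_gf_unique. *)

definition cp3_gf :: "int fps" where
  "cp3_gf = euler_f 3 ^ 6 * euler_f 6 ^ 6 * fps_right_inverse (euler_f 1 ^ 2 * euler_f 2 ^ 2) 1"

definition CP3 :: "nat \<Rightarrow> int" where
  "CP3 n = fps_nth cp3_gf n"

lemma euler_f_partial_coeff:
  assumes "m > 0" "k \<le> N"
  shows "fps_nth (\<Prod>n\<le>N. 1 - fps_X ^ (m * Suc n) :: int fps) k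
       = fps_nth (\<Prod>n\<le>k. 1 - fps_X ^ (m * Suc n) :: int fps) k"
  using assms(2)
proof (induction N rule: dec_induct)
  case (step N)
  have "k < m * Suc (Suc N)"
    using step.hyps assms(1)
    by (metis Suc_lessI le_imp_less_Suc less_SucI less_le_trans mult_le_mono1 nat_mult_1 One_nat_def Suc_leI)
  then show ?case
    using step.IH by (simp add: algebra_simps fps_X_power_mult_nth del: mult_Suc mult_Suc_right)
qed simp

lemma euler_f_has_prod:
  assumes "m > 0"
  shows "(\<lambda>n. 1 - fps_X ^ (m * Suc n)) has_prod euler_f m"
    and "(\<lambda>N. \<Prod>n\<le>N. 1 - fps_X ^ (m * Suc n)) \<longlonglongrightarrow> euler_f m"
    and "fps_nth (euler_f m) 0 = 1"
proof -
  define P where "P N = (\<Prod>n\<le>N. 1 - fps_X ^ (m * Suc n) :: int fps)" for N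
  define L where "L = Abs_fps (\<lambda>k. fps_nth (P k) k)"
  have lim: "P \<longlonglongrightarrow> L"
  proof (rule tendsto_fpsI)
    fix k
    have "fps_nth (P N) k = fps_nth L k" if "k \<le> N" for N
      using euler_f_partial_coeff[OF assms that] by (simp add: P_def L_def)
    then show "\<forall>\<^sub>F N in sequentially. fps_nth (P N) k = fps_nth L k"
      unfolding eventually_sequentially by blast
  qed
  have L0: "fps_nth L 0 = 1"
    using assms by (simp add: L_def P_def)
  then have "L \<noteq> 0" by auto
  with lim have prod: "(\<lambda>n. 1 - fps_X ^ (m * Suc n)) has_prod L"
    unfolding has_prod_def raw_has_prod_def P_def by auto
  then have "euler_f m = L"
    unfolding euler_f_def by (rule has_prod_unique[symmetric])
  with prod lim L0 show "(\<lambda>n. 1 - fps_X ^ (m * Suc n)) has_prod euler_f m"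
    and "(\<lambda>N. \<Prod>n\<le>N. 1 - fps_X ^ (m * Suc n)) \<longlonglongrightarrow> euler_f m"
    and "fps_nth (euler_f m) 0 = 1"
    unfolding P_def by metis+
qed

lemma cp3_denominator_nth_0: "fps_nth (euler_f 1 ^ 2 * euler_f 2 ^ 2) 0 = 1"
  unfolding power2_eq_square fps_mult_nth_0
  by (simp only: euler_f_has_prod(3)[OF zero_less_one] euler_f_has_prod(3)[OF zero_less_numeral] mult_1)

lemma cp3_gf_mult: "cp3_gf * (euler_f 1 ^ 2 * euler_f 2 ^ 2) = euler_f 3 ^ 6 * euler_f 6 ^ 6"
proof -
  have "(euler_f 1 ^ 2 * euler_f 2 ^ 2) * fps_right_inverse (euler_f 1 ^ 2 * euler_f 2 ^ 2) 1 = 1"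
    by (rule fps_right_inverse) (simp only: cp3_denominator_nth_0 mult_1)
  then show ?thesis
    unfolding cp3_gf_def by (simp only: mult.assoc mult.commute[of "fps_right_inverse _ _"] mult_1_right)
qed

lemma cp3_gf_unique:
  assumes "F * (euler_f 1 ^ 2 * euler_f 2 ^ 2) = euler_f 3 ^ 6 * euler_f 6 ^ 6"
  shows "F = cp3_gf"
proof -
  have "euler_f 1 ^ 2 * euler_f 2 ^ 2 \<noteq> 0"
    using cp3_denominator_nth_0 by (metis fps_zero_nth zero_neq_one)
  then show ?thesis
    using assms[folded cp3_gf_mult] by (rule mult_right_cancel[THEN iffD1])
qed

end

(* Put A = f_3^3 / f_1, so that the generating function is A(q)^2 A(q^2)^2.  Extracting a
   coefficient of z from products of the form prod (1 + z q^i) writes A as a theta series over the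
   lattice Z^2, and sorting the lattice points by parity gives A(q) = E(q^2) + q A(q^4), where
   E = f_2^3 f_3^2 / (f_1^2 f_6).  Hence sum CP_3(2n+1) q^n = 2 H with
   H = E(q) A(q)^2 A(q^2) = f_2^2 f_3^8 f_6^2 / f_1^4, and it remains to treat H modulo 8.
   With phi(q) = f_1^2 / f_2 = 1 + 2 s(q), where s is supported on squares, one gets
   H phi(q)^2 = phi(q^3)^4 phi(q^6)^3 f_12^3, and therefore
   H = f_12^3 phi(q^6)^3 + 4 f_12^3 (s + s^2) modulo 8.  The first term is a series in q^3, and
   modulo 2 the exponents of s + s^2 are squares or twice squares, so no exponent congruent
   to 7 or 10 modulo 12 survives. *)

theory Submission
  imports Defs
begin

subsection \<open>Gaussian binomial coefficients\<close>

text \<open>Integer power series allow neither general division nor negative powers of q, so each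
  theta identity is the limit of a polynomial one: Gaussian binomials are defined by a Pascal
  recursion that makes sense in any commutative semiring, a finite identity is proved exactly, and
  both sides are compared below an arbitrary degree M. The limit rests on one fact: a Gaussian
  binomial in base q^m tends to 1/f_m when its lower index and the complement both grow. The lattice
  appears as the triples of deviations with sum zero when three factors share a fixed power of z.
  Splitting prod (1 + z q^i) by i modulo 3 gives A. The series E belongs to prod (1 + z q^(2i)) (1 +
  z q^(2i+1))^2; merging two of its three progressions turns the lattice sum, up to Euler products,
  into a one-dimensional theta series. The parity sorting is arithmetic in the Eisenstein integers.
  Modulo 8 the denominator does no harm because phi(q)^4 = 1 there, so phi(q)^2 is its own inverse.
  The remaining f_12 is a series in q^12, which is why residues modulo 12 decide.\<close>

fun qbinom :: "'a::comm_semiring_1 \<Rightarrow> nat \<Rightarrow> nat \<Rightarrow> 'a" where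
  "qbinom p n 0 = 1"
| "qbinom p 0 (Suc k) = 0"
| "qbinom p (Suc n) (Suc k) = qbinom p n k + p ^ Suc k * qbinom p n (Suc k)"

lemma qbinom_eq_0: "n < k \<Longrightarrow> qbinom p n k = 0"
  by (induction p n k rule: qbinom.induct) auto

lemma Suc_choose_2: "Suc k choose 2 = (k choose 2) + k"
  by (simp add: numeral_2_eq_2)

lemma zero_choose_2 [simp]: "0 choose 2 = 0"
  by (simp add: numeral_2_eq_2)

text \<open>Pulling off the factor i = 0 leaves the same product with x * p for x, hence the
  induction over arbitrary x. The homogeneous variable y lets a high power of q stand where the
  classical proof would use negative powers; the general ring lets p be a constant
  polynomial.\<close>

theorem q_binomial_theorem:
  fixes x y p :: "'a::comm_semiring_1"
  shows "(\<Prod>i<n. y + x * p ^ i) = (\<Sum>k\<le>n. p ^ (k choose 2) * qbinom p n k * x ^ k * y ^ (n - k))"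
proof (induction n arbitrary: x)
  case (Suc n)
  define t where "t k = p ^ (k choose 2) * qbinom p n k * (x * p) ^ k * y ^ (n - k)" for k
  define u where "u k = p ^ (k choose 2) * p ^ k * qbinom p n k * x ^ k * y ^ (Suc n - k)" for k
  define w where "w k = p ^ (k choose 2) * qbinom p (Suc n) k * x ^ k * y ^ (Suc n - k)" for k
  have "(\<Prod>i<Suc n. y + x * p ^ i) = (y + x) * (\<Prod>i<n. y + (x * p) * p ^ i)"
    by (simp add: prod.lessThan_Suc_shift mult.assoc del: prod.lessThan_Suc)
  also have "\<dots> = (y + x) * (\<Sum>k\<le>n. t k)"
    by (simp only: Suc.IH t_def)
  also have "\<dots> = (\<Sum>k\<le>n. y * t k) + (\<Sum>k\<le>n. x * t k)"
    by (simp only: distrib_right sum_distrib_left sum.distrib)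
  also have "(\<Sum>k\<le>n. y * t k) = (\<Sum>k\<le>n. u k)"
    unfolding t_def u_def
    by (intro sum.cong refl) (simp add: power_mult_distrib Suc_diff_le mult_ac)
  also have "\<dots> = (\<Sum>k\<le>Suc n. u k)"
    by (simp add: u_def qbinom_eq_0)
  also have "\<dots> = u 0 + (\<Sum>k\<le>n. u (Suc k))"
    by (rule sum.atMost_Suc_shift)
  also have "\<dots> + (\<Sum>k\<le>n. x * t k) = u 0 + (\<Sum>k\<le>n. u (Suc k) + x * t k)"
    by (simp only: sum.distrib add.assoc)
  also have "(\<Sum>k\<le>n. u (Suc k) + x * t k) = (\<Sum>k\<le>n. w (Suc k))"
    unfolding t_def u_def w_def
    by (intro sum.cong refl) (simp add: Suc_choose_2 power_add power_mult_distrib distrib_left distrib_right mult_ac add_ac)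
  also have "u 0 = w 0"
    by (simp add: u_def w_def)
  also have "w 0 + (\<Sum>k\<le>n. w (Suc k)) = (\<Sum>k\<le>Suc n. w k)"
    by (rule sum.atMost_Suc_shift[symmetric])
  finally show ?case
    unfolding w_def .
qed simp

definition qpoch :: "'a::comm_ring_1 \<Rightarrow> nat \<Rightarrow> 'a" where
  "qpoch p n = (\<Prod>i<n. 1 - p ^ Suc i)"

lemma qpoch_simps [simp]: "qpoch p 0 = 1" "qpoch p (Suc n) = qpoch p n * (1 - p ^ Suc n)"
  by (simp_all add: qpoch_def)

lemma qbinom_self: "qbinom p n n = 1"
  by (induction n) (simp_all add: qbinom_eq_0)

text \<open>Division-free form of the quotient formula. The two Pascal terms are joined by (1 - p^a)
  + p^a (1 - p^b) = 1 - p^(a+b).\<close>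

lemma qbinom_qpoch: "qbinom p (a + b) a * qpoch p a * qpoch p b = qpoch p (a + b)"
proof (induction "a + b" arbitrary: a b)
  case (Suc n)
  show ?case
  proof (cases "a = 0 \<or> b = 0")
    case False
    then obtain c d where cd: "a = Suc c" "b = Suc d"
      by (metis not0_implies_Suc)
    have 1: "qbinom p (c + Suc d) c * qpoch p c * qpoch p (Suc d) = qpoch p (c + Suc d)"
      and 2: "qbinom p (Suc c + d) (Suc c) * qpoch p (Suc c) * qpoch p d = qpoch p (Suc c + d)"
      using Suc.hyps cd by (metis add_Suc add_Suc_right nat.inject)+
    have "qbinom p (a + b) a * qpoch p a * qpoch p b
        = qbinom p (c + Suc d) c * qpoch p c * qpoch p (Suc d) * (1 - p ^ Suc c)
          + p ^ Suc c * (1 - p ^ Suc d) * (qbinom p (Suc c + d) (Suc c) * qpoch p (Suc c) * qpoch p d)"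
      unfolding cd by (simp add: algebra_simps)
    also have "\<dots> = qpoch p (Suc c + d) * (1 - p ^ (Suc (Suc c + d)))"
      unfolding 1 2 by (simp add: algebra_simps power_add)
    finally show ?thesis
      by (simp add: cd)
  qed (auto simp: qbinom_self)
qed simp

subsection \<open>Truncated comparison of power series\<close>

text \<open>Congruence modulo q^M; limits in N are replaced by choosing N large in terms of
  M.\<close>

definition eq_upto :: "nat \<Rightarrow> 'a::comm_ring_1 fps \<Rightarrow> 'a fps \<Rightarrow> bool" where
  "eq_upto M f g \<longleftrightarrow> (\<forall>m<M. fps_nth f m = fps_nth g m)"

lemma eq_upto_refl [simp, intro]: "eq_upto M f f"
  by (simp add: eq_upto_def)

lemma eq_upto_sym: "eq_upto M f g \<Longrightarrow> eq_upto M g f"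
  by (simp add: eq_upto_def)

lemma eq_upto_trans [trans]: "eq_upto M f g \<Longrightarrow> eq_upto M g h \<Longrightarrow> eq_upto M f h"
  by (simp add: eq_upto_def)

lemma eq_upto_mult: "eq_upto M f g \<Longrightarrow> eq_upto M f' g' \<Longrightarrow> eq_upto M (f * f') (g * g')"
  by (auto simp: eq_upto_def fps_mult_nth intro!: sum.cong)

lemma eq_upto_power: "eq_upto M f g \<Longrightarrow> eq_upto M (f ^ n) (g ^ n)"
  by (induction n) (auto intro: eq_upto_mult)

lemma eq_upto_sum: "(\<And>v. v \<in> S \<Longrightarrow> eq_upto M (f v) (g v)) \<Longrightarrow> eq_upto M (\<Sum>v\<in>S. f v) (\<Sum>v\<in>S. g v)"
  by (auto simp: eq_upto_def fps_sum_nth intro!: sum.cong)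

lemma eq_upto_X_power: "M \<le> n \<Longrightarrow> eq_upto M (fps_X ^ n * f) 0"
  by (simp add: eq_upto_def fps_X_power_mult_nth)

lemma eq_upto_imp_eq: "(\<And>M. eq_upto M f g) \<Longrightarrow> f = g"
  by (auto simp: eq_upto_def fps_eq_iff)

lemma eq_upto_qpoch_euler_f:
  assumes "m > 0" "M \<le> n"
  shows "eq_upto M (qpoch (fps_X ^ m) n) (euler_f m)"
  unfolding eq_upto_def
proof (intro allI impI)
  fix k assume "k < M"
  define P where "P N = (\<Prod>n\<le>N. 1 - fps_X ^ (m * Suc n) :: int fps)" for N
  have P: "qpoch (fps_X ^ m) (Suc N) = P N" for N
    unfolding qpoch_def P_def lessThan_Suc_atMost by (simp only: power_mult)
  \<comment> \<open>Convergence yields the coefficient only at some large N; stability of the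
    partial products brings it back to N = k.\<close>
  have lim: "\<forall>\<^sub>F N in sequentially. fps_nth (P N) k = fps_nth (euler_f m) k"
    using euler_f_has_prod(2)[OF assms(1)] unfolding P_def tendsto_fps_iff by blast
  obtain N where "N \<ge> k" "fps_nth (P N) k = fps_nth (euler_f m) k"
    using eventually_conj[OF lim eventually_ge_at_top[of k]] by (auto dest: eventually_happens)
  then have "fps_nth (euler_f m) k = fps_nth (P k) k"
    unfolding P_def using euler_f_partial_coeff[OF assms(1)] by metis
  \<comment> \<open>\<open>qpoch\<close> with parameter n has n factors but \<open>P n\<close> has n
    + 1, hence n - 1 here; k < M <= n keeps n positive.\<close>
  moreover have "fps_nth (P (n - 1)) k = fps_nth (P k) k"
    unfolding P_def using euler_f_partial_coeff[OF assms(1), of k "n - 1"] \<open>k < M\<close> assms(2) by simp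
  ultimately show "fps_nth (qpoch (fps_X ^ m) n) k = fps_nth (euler_f m) k"
    using P[of "n - 1"] \<open>k < M\<close> assms(2) by simp
qed

section \<open>Reciprocals of Euler products as limits of Gaussian binomials\<close>

definition euler_inv :: "nat \<Rightarrow> int fps" where
  "euler_inv m = fps_right_inverse (euler_f m) 1"

lemma euler_f_mult_inv: "m > 0 \<Longrightarrow> euler_f m * euler_inv m = 1"
  unfolding euler_inv_def by (rule fps_right_inverse) (simp add: euler_f_has_prod(3))

text \<open>Below degree M all three products in \<open>qbinom_qpoch\<close> agree with f_m, so the
  binomial times f_m^2 agrees with f_m; multiply by the square of the reciprocal.\<close>

lemma eq_upto_qbinom:
  assumes "m > 0" "M \<le> a" "M \<le> b"
  shows "eq_upto M (qbinom (fps_X ^ m) (a + b) a) (euler_inv m)"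
proof -
  let ?f = "euler_f m" and ?g = "euler_inv m" and ?B = "qbinom (fps_X ^ m :: int fps) (a + b) a"
  have "eq_upto M (?B * ?f * ?f) (?B * qpoch (fps_X ^ m) a * qpoch (fps_X ^ m) b)"
    using assms by (intro eq_upto_mult eq_upto_refl eq_upto_qpoch_euler_f[THEN eq_upto_sym]) auto
  also have "?B * qpoch (fps_X ^ m) a * qpoch (fps_X ^ m) b = qpoch (fps_X ^ m) (a + b)"
    by (rule qbinom_qpoch)
  also have "eq_upto M \<dots> ?f"
    using assms by (intro eq_upto_qpoch_euler_f) auto
  finally have "eq_upto M (?B * ?f * ?f * (?g * ?g)) (?f * (?g * ?g))"
    by (rule eq_upto_mult) auto
  moreover have "?B * ?f * ?f * (?g * ?g) = ?B * (?f * ?g) * (?f * ?g)" "?f * (?g * ?g) = ?f * ?g * ?g"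
    by (simp_all only: mult_ac)
  ultimately show ?thesis
    by (simp add: euler_f_mult_inv[OF assms(1)])
qed

section \<open>Theta series as limits of weighted finite sums\<close>

text \<open>If some fibre of \<^term>\<open>e\<close> is infinite, the corresponding coefficient is the junk value 0.\<close>

definition theta :: "('a \<Rightarrow> int) \<Rightarrow> ('a \<Rightarrow> int) \<Rightarrow> int fps" where
  "theta s e = Abs_fps (\<lambda>m. \<Sum>v | e v = int m. s v)"

text \<open>A discrete dominated convergence: a point with \<open>e v\<close> at least M contributes
  nothing below degree M, whatever its weight, so only the points below M need weights close to the
  limit c.\<close>

lemma eq_upto_theta:
  assumes "finite S" "\<And>v. e v \<ge> 0" "\<And>v. e v < int M \<Longrightarrow> v \<in> S"
    and "\<And>v. v \<in> S \<Longrightarrow> e v < int M \<Longrightarrow> eq_upto M (w v) c"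
  shows "eq_upto M (\<Sum>v\<in>S. of_int (s v) * fps_X ^ nat (e v) * w v) (theta s e * c)"
proof -
  have "eq_upto M (\<Sum>v\<in>S. of_int (s v) * fps_X ^ nat (e v) * w v) (\<Sum>v\<in>S. of_int (s v) * fps_X ^ nat (e v) * c)"
  proof (rule eq_upto_sum)
    fix v assume v: "v \<in> S"
    show "eq_upto M (of_int (s v) * fps_X ^ nat (e v) * w v) (of_int (s v) * fps_X ^ nat (e v) * c)"
    proof (cases "e v < int M")
      case True
      with v assms(4) show ?thesis by (intro eq_upto_mult) auto
    next
      case False
      then have "M \<le> nat (e v)" by simp
      then have "eq_upto M (of_int (s v) * fps_X ^ nat (e v) * h) 0" for h :: "int fps"
        using eq_upto_X_power[of M "nat (e v)" "of_int (s v) * h"] by (simp only: mult_ac)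
      then show ?thesis
        by (blast intro: eq_upto_sym eq_upto_trans)
    qed
  qed
  also have "\<dots> = (\<Sum>v\<in>S. of_int (s v) * fps_X ^ nat (e v)) * c"
    by (simp add: sum_distrib_right)
  also have "eq_upto M \<dots> (theta s e * c)"
  proof (intro eq_upto_mult eq_upto_refl)
    show "eq_upto M (\<Sum>v\<in>S. of_int (s v) * fps_X ^ nat (e v)) (theta s e)"
      unfolding eq_upto_def
    proof (intro allI impI)
      fix m assume "m < M"
      have "fps_nth (\<Sum>v\<in>S. of_int (s v) * fps_X ^ nat (e v)) m = (\<Sum>v\<in>S. if e v = int m then s v else 0)"
        unfolding fps_sum_nth
      proof (rule sum.cong)
        fix v
        have "fps_nth (of_int (s v) * fps_X ^ nat (e v)) m = s v * fps_nth (fps_X ^ nat (e v)) m"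
          by (simp flip: fps_of_int)
        then show "fps_nth (of_int (s v) * fps_X ^ nat (e v)) m = (if e v = int m then s v else 0)"
          using assms(2)[of v] by auto
      qed simp
      also have "\<dots> = (\<Sum>v | e v = int m. s v)"
        using assms(1,3) \<open>m < M\<close> by (intro sum.mono_neutral_cong_right) auto
      finally show "fps_nth (\<Sum>v\<in>S. of_int (s v) * fps_X ^ nat (e v)) m = fps_nth (theta s e) m"
        by (simp add: theta_def)
    qed
  qed
  finally show ?thesis .
qed

subsection \<open>The Jacobi triple product\<close>

text \<open>An offset u from the centre costs |u| degrees of precision.\<close>

lemma eq_upto_qbinom_central:
  assumes "m > 0" "\<bar>u\<bar> + int M \<le> int N"
  shows "eq_upto M (qbinom (fps_X ^ m) (2 * N) (nat (int N + u))) (euler_inv m)"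
proof -
  have "2 * N = nat (int N + u) + nat (int N - u)"
    using assms(2) by linarith
  moreover have "M \<le> nat (int N + u)" "M \<le> nat (int N - u)"
    using assms(2) by linarith+
  ultimately show ?thesis
    using eq_upto_qbinom[OF assms(1)] by metis
qed

lemma euler_f_cancel: "m > 0 \<Longrightarrow> f * euler_inv m = g \<Longrightarrow> f = g * euler_f m"
  by (metis euler_f_mult_inv mult.assoc mult.commute mult_1_right)

lemma two_choose_two: "2 * int (k choose 2) = int k * (int k - 1)"
  by (induction k) (simp_all add: Suc_choose_2 algebra_simps)

definition tri :: "int \<Rightarrow> int" where
  "tri u = u * (u + 1) div 2"

lemma two_tri: "2 * tri u = u * (u + 1)"
  unfolding tri_def by simp

lemma tri_nonneg: "0 \<le> tri u"
proof -
  have "0 \<le> u * (u + 1)"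
    by (cases "u \<ge> 0") (auto intro: mult_nonpos_nonpos)
  then show ?thesis
    using two_tri[of u] by linarith
qed

lemma abs_le_square: "\<bar>u\<bar> \<le> u\<^sup>2" for u :: int
proof (cases "u = 0")
  case False
  then have "\<bar>u\<bar> * 1 \<le> \<bar>u\<bar> * \<bar>u\<bar>"
    by (intro mult_left_mono) auto
  then show ?thesis
    by (simp add: power2_eq_square abs_mult_self_eq)
qed simp

lemma prod_lessThan_add: "(\<Prod>i<a + b. g i) = (\<Prod>i<a. g i) * (\<Prod>i<b. g (a + i))"
  for g :: "nat \<Rightarrow> 'a::comm_monoid_mult"
  by (induction b) (simp_all add: mult_ac)

lemma prod_geometric: "(\<Prod>i<n. c * q ^ (r + d * i)) = c ^ n * q ^ (d * (n choose 2) + r * n)"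
  for c q :: "'a::comm_semiring_1"
  by (induction n) (simp_all add: Suc_choose_2 power_add algebra_simps)

text \<open>The $q$-binomial theorem with $x = s q^r$, $y = q^{dN}$ and $2N$ factors; a common factor
  $s^N q^C$ is cancelled. As $N$ grows this becomes Ramanujan's form of the triple product.\<close>

lemma triple_product_finite:
  fixes s :: int
  assumes s: "s * s = 1" and d: "d = r + r'"
  shows "(\<Sum>u\<in>{-int N..int N}. of_int (s ^ nat \<bar>u\<bar>) * fps_X ^ nat (int r * tri u + int r' * tri (- u))
            * qbinom (fps_X ^ d) (2 * N) (nat (int N + u)))
       = (\<Prod>i<N. (1 + of_int s * fps_X ^ (d * i + r)) * (1 + of_int s * fps_X ^ (d * i + r')) :: int fps)"
    (is "(\<Sum>u\<in>_. ?t u) = ?R")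
proof -
  define X :: "int fps" where "X = fps_X"
  define \<sigma> :: "int fps" where "\<sigma> = of_int s"
  define C where "C = d * (N choose 2) + r * N + d * N * N"
  have \<sigma>: "\<sigma> * \<sigma> = 1"
    using s unfolding \<sigma>_def by (metis of_int_1 of_int_mult)
  \<comment> \<open>Since \<sigma> is its own inverse, the power belonging to a negative u depends
    only on |u|.\<close>
  have \<sigma>_pow: "\<sigma> ^ nat (int N + u) = \<sigma> ^ N * \<sigma> ^ nat \<bar>u\<bar>" if "- int N \<le> u" for u
  proof (cases "u \<ge> 0")
    case True
    then show ?thesis by (simp add: nat_add_distrib power_add)
  next
    case False
    then have "N = nat (int N + u) + nat \<bar>u\<bar>" using that by linarith
    then have "\<sigma> ^ N = \<sigma> ^ nat (int N + u) * \<sigma> ^ nat \<bar>u\<bar>"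
      by (metis power_add)
    then have "\<sigma> ^ N * \<sigma> ^ nat \<bar>u\<bar> = \<sigma> ^ nat (int N + u) * (\<sigma> * \<sigma>) ^ nat \<bar>u\<bar>"
      by (simp only: mult.assoc power_mult_distrib)
    then show ?thesis by (simp add: \<sigma>)
  qed
  \<comment> \<open>C is the exponent of the central term u = 0. Doubling clears the halves in the
    binomial coefficients and in \<open>tri\<close>.\<close>
  have expo: "d * (k choose 2) + r * k + d * N * (2 * N - k) = C + nat (int r * tri u + int r' * tri (- u))"
    if "u \<in> {-int N..int N}" "k = nat (int N + u)" for u k
  proof -
    have k: "int k = int N + u" "int (2 * N - k) = int N - u"
      using that by auto
    have "2 * (int d * int (k choose 2) + int r * int k + int d * int N * int (2 * N - k))
        = int d * (2 * int (k choose 2)) + 2 * int r * int k + 2 * int d * int N * int (2 * N - k)"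
      by (simp add: algebra_simps)
    also have "\<dots> = int d * (2 * int (N choose 2)) + 2 * int r * int N + 2 * int d * int N * int N
        + int r * (2 * tri u) + int r' * (2 * tri (- u))"
      unfolding two_choose_two two_tri k by (simp add: d algebra_simps)
    also have "\<dots> = 2 * (int C + (int r * tri u + int r' * tri (- u)))"
      by (simp add: C_def algebra_simps)
    finally have "int (d * (k choose 2) + r * k + d * N * (2 * N - k))
        = int (C + nat (int r * tri u + int r' * tri (- u)))"
      by (simp add: tri_nonneg)
    then show ?thesis
      by (simp only: of_nat_eq_iff)
  qed
  have "\<sigma> ^ N * X ^ C * (\<Sum>u\<in>{-int N..int N}. ?t u)
      = (\<Sum>u\<in>{-int N..int N}. (X ^ d) ^ (nat (int N + u) choose 2) * qbinom (X ^ d) (2 * N) (nat (int N + u))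
          * (\<sigma> * X ^ r) ^ nat (int N + u) * (X ^ (d * N)) ^ (2 * N - nat (int N + u)))"
    unfolding sum_distrib_left
  proof (rule sum.cong)
    fix u assume u: "u \<in> {-int N..int N}"
    define k where "k = nat (int N + u)"
    have "(X ^ d) ^ (k choose 2) * qbinom (X ^ d) (2 * N) k * (\<sigma> * X ^ r) ^ k * (X ^ (d * N)) ^ (2 * N - k)
        = \<sigma> ^ k * X ^ (d * (k choose 2) + r * k + d * N * (2 * N - k)) * qbinom (X ^ d) (2 * N) k"
      by (simp add: power_mult[symmetric] power_add power_mult_distrib mult.commute mult.left_commute)
    also have "\<dots> = \<sigma> ^ N * X ^ C * ?t u"
      unfolding expo[OF u k_def] using \<sigma>_pow[of u] u
      by (simp add: k_def power_add X_def \<sigma>_def mult_ac)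
    finally show "\<sigma> ^ N * X ^ C * ?t u = (X ^ d) ^ (nat (int N + u) choose 2) * qbinom (X ^ d) (2 * N) (nat (int N + u))
          * (\<sigma> * X ^ r) ^ nat (int N + u) * (X ^ (d * N)) ^ (2 * N - nat (int N + u))"
      by (simp only: k_def)
  qed simp
  also have "\<dots> = (\<Sum>k\<le>2 * N. (X ^ d) ^ (k choose 2) * qbinom (X ^ d) (2 * N) k
          * (\<sigma> * X ^ r) ^ k * (X ^ (d * N)) ^ (2 * N - k))"
    by (rule sum.reindex_bij_witness[where i = "\<lambda>k. int k - int N" and j = "\<lambda>u. nat (int N + u)"]) auto
  also have "\<dots> = (\<Prod>i<2 * N. X ^ (d * N) + \<sigma> * X ^ r * (X ^ d) ^ i)"
    by (rule q_binomial_theorem[symmetric])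
  also have "\<dots> = (\<Prod>i<N. X ^ (d * N) + \<sigma> * X ^ (r + d * i)) * (\<Prod>i<N. X ^ (d * N) + \<sigma> * X ^ (r + d * (N + i)))"
    unfolding mult_2 prod_lessThan_add by (simp only: mult.assoc power_mult[symmetric] power_add[symmetric])
  also have "(\<Prod>i<N. X ^ (d * N) + \<sigma> * X ^ (r + d * (N + i))) = (\<Prod>i<N. X ^ (d * N) * (1 + \<sigma> * X ^ (d * i + r)))"
    by (intro prod.cong refl) (simp add: power_add algebra_simps)
  also have "\<dots> = X ^ (d * N * N) * (\<Prod>i<N. 1 + \<sigma> * X ^ (d * i + r))"
    by (simp add: prod.distrib power_mult)
  \<comment> \<open>In these factors q^(dN) is the higher power, so the other summand is pulled out;
    \<sigma>^2 = 1 moves the sign into the bracket, and reversing the index yields the progression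
    with r'.\<close>
  also have "(\<Prod>i<N. X ^ (d * N) + \<sigma> * X ^ (r + d * i))
      = (\<Prod>i<N. \<sigma> * X ^ (r + d * i) * (1 + \<sigma> * X ^ (d * (N - Suc i) + r')))"
  proof (intro prod.cong refl)
    fix i assume "i \<in> {..<N}"
    then obtain j where "N = Suc i + j"
      using less_imp_add_positive by (metis lessThan_iff less_iff_Suc_add add_Suc)
    then have "d * N = r + d * i + (d * (N - Suc i) + r')"
      by (simp add: d algebra_simps)
    then have "X ^ (d * N) = \<sigma> * \<sigma> * X ^ (r + d * i) * X ^ (d * (N - Suc i) + r')"
      by (simp only: \<sigma> power_add mult_1_left)
    then show "X ^ (d * N) + \<sigma> * X ^ (r + d * i) = \<sigma> * X ^ (r + d * i) * (1 + \<sigma> * X ^ (d * (N - Suc i) + r'))"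
      by (simp only: distrib_left mult_1_right mult_1_left mult.assoc mult.commute mult.left_commute add.commute)
  qed
  also have "\<dots> = \<sigma> ^ N * X ^ (d * (N choose 2) + r * N) * (\<Prod>i<N. 1 + \<sigma> * X ^ (d * i + r'))"
    by (subst prod.distrib)
       (simp only: prod_geometric prod.nat_diff_reindex[of "\<lambda>i. 1 + \<sigma> * X ^ (d * i + r')" N])
  finally have eq: "\<sigma> ^ N * X ^ C * (\<Sum>u\<in>{-int N..int N}. ?t u) = \<sigma> ^ N * X ^ C * ?R"
    by (simp add: C_def power_add prod.distrib X_def \<sigma>_def mult_ac)
  have "\<sigma> \<noteq> 0"
    using \<sigma> by auto
  then have "\<sigma> ^ N * X ^ C \<noteq> 0"
    by (simp add: X_def)
  then show ?thesis
    using eq by (rule mult_left_cancel[THEN iffD1])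
qed

text \<open>Ramanujan's f(a, b) at a = s q^r, b = s q^r'. For s = 1 or s = -1 the factor s^(u^2)
  equals s^|u|.\<close>

definition rtheta :: "int \<Rightarrow> nat \<Rightarrow> nat \<Rightarrow> int fps" where
  "rtheta s r r' = theta (\<lambda>u. s ^ nat \<bar>u\<bar>) (\<lambda>u. int r * tri u + int r' * tri (- u))"

text \<open>The exponent is at least |u|, so contributing terms have |u| < M, and 2M <= N leaves M
  degrees of precision in their binomials.\<close>

lemma eq_upto_rtheta:
  assumes s: "s * s = 1" and r: "r > 0" "r' > 0" and N: "2 * M \<le> N"
  shows "eq_upto M (\<Prod>i<N. (1 + of_int s * fps_X ^ ((r + r') * i + r)) * (1 + of_int s * fps_X ^ ((r + r') * i + r')))
           (rtheta s r r' * euler_inv (r + r'))"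
  unfolding triple_product_finite[OF s refl, symmetric] rtheta_def
proof (rule eq_upto_theta)
  have bound: "\<bar>u\<bar> \<le> int r * tri u + int r' * tri (- u)" for u
  proof -
    have "tri u + tri (- u) = u\<^sup>2"
      using two_tri[of u] two_tri[of "- u"] by (simp add: power2_eq_square algebra_simps)
    moreover have "1 * tri u \<le> int r * tri u" "1 * tri (- u) \<le> int r' * tri (- u)"
      using r by (intro mult_right_mono tri_nonneg; simp)+
    ultimately show ?thesis
      using abs_le_square[of u] by linarith
  qed
  show "0 \<le> int r * tri u + int r' * tri (- u)" for u
    by (simp add: tri_nonneg)
  show "u \<in> {- int N..int N}" if "int r * tri u + int r' * tri (- u) < int M" for u
    using bound[of u] that N by auto
  show "eq_upto M (qbinom (fps_X ^ (r + r')) (2 * N) (nat (int N + u))) (euler_inv (r + r'))"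
    if "int r * tri u + int r' * tri (- u) < int M" for u
    using bound[of u] that N r by (intro eq_upto_qbinom_central) auto
qed simp

section \<open>Product formulas for two theta functions\<close>

lemma prod_lessThan_double: "(\<Prod>i<2 * n. g i) = (\<Prod>i<n. g (2 * i) * g (2 * i + 1))"
  for g :: "nat \<Rightarrow> 'a::comm_monoid_mult"
  by (induction n) (simp_all add: mult_ac)

lemma prod_lessThan_triple: "(\<Prod>i<3 * n. g i) = (\<Prod>i<n. g (3 * i) * g (3 * i + 1) * g (3 * i + 2))"
  for g :: "nat \<Rightarrow> 'a::comm_monoid_mult"
  by (induction n) (simp_all add: numeral_3_eq_3 mult_ac)

text \<open>The triple product is (q;q^2)^2 (q^2;q^2), and splitting the factors of (q;q) by parity
  gives (q;q^2) = f_1 / f_2.\<close>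

lemma rtheta_1_1: "rtheta (-1) 1 1 * euler_f 2 = euler_f 1 ^ 2"
proof -
  have "eq_upto M (rtheta (-1) 1 1 * euler_inv 2 * euler_f 2 ^ 2) (euler_f 1 ^ 2)" for M
  proof -
    define N where "N = 2 * M"
    define P :: "int fps" where "P = (\<Prod>i<N. 1 - fps_X ^ (2 * i + 1))"
    have "qpoch fps_X (2 * N) = P * qpoch (fps_X ^ 2) N"
      unfolding qpoch_def prod_lessThan_double prod.distrib P_def
      by (simp add: power_mult[symmetric] power_Suc[symmetric] del: power_Suc)
    moreover have "(\<Prod>i<N. (1 + of_int (-1) * fps_X ^ ((1 + 1) * i + 1)) * (1 + of_int (-1) * fps_X ^ ((1 + 1) * i + 1))) = P * P"
      unfolding P_def prod.distrib[symmetric] by (simp add: mult_2)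
    ultimately have eq: "(\<Prod>i<N. (1 + of_int (-1) * fps_X ^ ((1 + 1) * i + 1)) * (1 + of_int (-1) * fps_X ^ ((1 + 1) * i + 1)))
        * qpoch (fps_X ^ 2) N ^ 2 = (qpoch (fps_X ^ 1) (2 * N) ^ 2 :: int fps)"
      by (simp only: power_mult_distrib power2_eq_square[of P] power_one_right)
    have "eq_upto M ((\<Prod>i<N. (1 + of_int (-1) * fps_X ^ ((1 + 1) * i + 1)) * (1 + of_int (-1) * fps_X ^ ((1 + 1) * i + 1)))
        * qpoch (fps_X ^ 2) N ^ 2) (rtheta (-1) 1 1 * euler_inv (1 + 1) * euler_f 2 ^ 2)"
      by (intro eq_upto_mult eq_upto_rtheta eq_upto_power eq_upto_qpoch_euler_f) (auto simp: N_def)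
    moreover have "eq_upto M (qpoch (fps_X ^ 1) (2 * N) ^ 2) (euler_f 1 ^ 2)"
      by (intro eq_upto_power eq_upto_qpoch_euler_f) (auto simp: N_def)
    ultimately have "eq_upto M (rtheta (-1) 1 1 * euler_inv (1 + 1) * euler_f 2 ^ 2) (euler_f 1 ^ 2)"
      unfolding eq by (rule eq_upto_trans[OF eq_upto_sym])
    then show ?thesis
      by (simp only: one_add_one)
  qed
  then have "rtheta (-1) 1 1 * euler_inv 2 * euler_f 2 ^ 2 = euler_f 1 ^ 2"
    by (rule eq_upto_imp_eq)
  then have "rtheta (-1) 1 1 * euler_f 2 * (euler_f 2 * euler_inv 2) = euler_f 1 ^ 2"
    by (simp only: power2_eq_square[of "euler_f 2"] mult_ac)
  then show ?thesis
    by (simp only: euler_f_mult_inv zero_less_numeral mult_1_right)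
qed

text \<open>The exponents 3i + 1 and 3i + 2 are those prime to 3, so the plus-products form (-q;q) /
  (-q^3;q^3); then (1 + x)(1 - x) = 1 - x^2 turns both into Euler products.\<close>

lemma rtheta_2_1: "rtheta 1 2 1 * euler_f 1 * euler_f 6 = euler_f 2 * euler_f 3 ^ 2"
proof -
  have "eq_upto M (rtheta 1 2 1 * euler_inv 3 * (euler_f 6 * euler_f 1)) (euler_f 2 * euler_f 3)" for M
  proof -
    define N where "N = 2 * M"
    let ?R = "\<Prod>i<N. (1 + of_int 1 * fps_X ^ ((2 + 1) * i + 2)) * (1 + of_int 1 * fps_X ^ ((2 + 1) * i + 1)) :: int fps"
    have rearrange: "R * (S * P) = Q * C" if "R * V = U" "U * P = Q" "V * C = S" for R V U P Q C S :: "int fps"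
      using that by (auto simp: mult_ac)
    have diff_sq: "(1 + fps_X ^ k) * (1 - fps_X ^ k) = (1 - (fps_X ^ 2) ^ k :: int fps)" for k
      by (simp add: power2_eq_square power_mult_distrib algebra_simps)
    have "?R * (\<Prod>i<N. 1 + fps_X ^ (3 * i + 3)) = (\<Prod>i<3 * N. 1 + fps_X ^ Suc i)"
      unfolding prod_lessThan_triple prod.distrib by (simp add: mult_ac numeral_3_eq_3)
    moreover have "(\<Prod>i<3 * N. 1 + fps_X ^ Suc i) * qpoch fps_X (3 * N) = (qpoch (fps_X ^ 2) (3 * N) :: int fps)"
      unfolding qpoch_def prod.distrib[symmetric] diff_sq ..
    moreover have "(\<Prod>i<N. 1 + fps_X ^ (3 * i + 3)) * qpoch (fps_X ^ 3) N = (qpoch (fps_X ^ 6) N :: int fps)"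
    proof -
      have "1 + fps_X ^ (3 * i + 3) = (1 + (fps_X ^ 3) ^ Suc i :: int fps)" for i
        by (simp add: power_mult[symmetric] power_add)
      then show ?thesis
        unfolding qpoch_def prod.distrib[symmetric]
        by (intro prod.cong refl) (simp only: power_mult[symmetric] diff_sq, simp add: mult.commute flip: power_mult)
    qed
    ultimately have eq: "?R * (qpoch (fps_X ^ 6) N * qpoch (fps_X ^ 1) (3 * N)) = qpoch (fps_X ^ 2) (3 * N) * qpoch (fps_X ^ 3) N"
      unfolding power_one_right using rearrange by blast
    have "eq_upto M (?R * (qpoch (fps_X ^ 6) N * qpoch (fps_X ^ 1) (3 * N)))
        (rtheta 1 2 1 * euler_inv (2 + 1) * (euler_f 6 * euler_f 1))"
      by (intro eq_upto_mult eq_upto_rtheta eq_upto_qpoch_euler_f) (auto simp: N_def)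
    moreover have "eq_upto M (qpoch (fps_X ^ 2) (3 * N) * qpoch (fps_X ^ 3) N) (euler_f 2 * euler_f 3)"
      by (intro eq_upto_mult eq_upto_qpoch_euler_f) (auto simp: N_def)
    ultimately have "eq_upto M (rtheta 1 2 1 * euler_inv (2 + 1) * (euler_f 6 * euler_f 1)) (euler_f 2 * euler_f 3)"
      unfolding eq by (rule eq_upto_trans[OF eq_upto_sym])
    then show ?thesis
      by simp
  qed
  then have "rtheta 1 2 1 * euler_inv 3 * (euler_f 6 * euler_f 1) = euler_f 2 * euler_f 3"
    by (rule eq_upto_imp_eq)
  then have "rtheta 1 2 1 * euler_f 6 * euler_f 1 * euler_inv 3 = euler_f 2 * euler_f 3"
    by (simp only: mult_ac)
  from euler_f_cancel[OF _ this] show ?thesis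
    by (simp add: power2_eq_square mult_ac)
qed

subsection \<open>Double theta series by coefficient extraction\<close>

lemma qbinom_const_poly: "qbinom [:p:] n k = [:qbinom p n k:]"
  by (induction p n k rule: qbinom.induct) (simp_all add: poly_const_pow one_pCons mult_ac)

text \<open>The polynomial variable is the auxiliary z, while q lives in the coefficients;
  extracting a power of z is then just \<open>coeff\<close>.\<close>

definition linprod :: "nat \<Rightarrow> nat \<Rightarrow> nat \<Rightarrow> int fps poly" where
  "linprod d r n = (\<Prod>i<n. [:1, fps_X ^ (d * i + r):])"

lemma coeff_linprod:
  "coeff (linprod d r n) k = fps_X ^ (d * (k choose 2) + r * k) * qbinom (fps_X ^ d) n k"
proof -
  have "linprod d r n = (\<Prod>i<n. [:1:] + monom (fps_X ^ r) 1 * [:fps_X ^ d:] ^ i)"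
    unfolding linprod_def
    by (intro prod.cong refl) (simp add: poly_const_pow monom_Suc monom_0 power_add power_mult[symmetric] mult.commute)
  also have "\<dots> = (\<Sum>j\<le>n. monom (fps_X ^ (d * (j choose 2) + r * j) * qbinom (fps_X ^ d) n j) j)"
    unfolding q_binomial_theorem qbinom_const_poly
    by (intro sum.cong refl)
       (simp add: poly_const_pow monom_power power_mult[symmetric] power_add smult_monom mult_ac)
  finally show ?thesis
    by (simp add: coeff_sum qbinom_eq_0)
qed

text \<open>A pair \<^term>\<open>(u, v)\<close> stands for the triple $(-u-v, u, v)$ of integers with sum zero.\<close>

definition hex_index :: "nat \<Rightarrow> (int \<times> int) set" where
  "hex_index N = {(u, v). - int N \<le> u \<and> - int N \<le> v \<and> u + v \<le> int N}"

lemma finite_hex_index: "finite (hex_index N)"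
  by (rule finite_subset[of _ "{- int N..2 * int N} \<times> {- int N..2 * int N}"]) (auto simp: hex_index_def)

lemma coeff_mult3_hex:
  fixes p q r :: "'a::comm_ring_1 poly"
  shows "coeff (p * q * r) (3 * N) = (\<Sum>(u, v)\<in>hex_index N.
           coeff p (nat (int N - u - v)) * coeff q (nat (int N + u)) * coeff r (nat (int N + v)))"
proof -
  have "coeff (p * q * r) (3 * N) = coeff (q * (r * p)) (3 * N)"
    by (simp only: mult_ac)
  also have "\<dots> = (\<Sum>(i, j)\<in>(SIGMA i:{..3 * N}. {..3 * N - i}). coeff q i * (coeff r j * coeff p (3 * N - i - j)))"
    by (simp add: coeff_mult sum_distrib_left sum.Sigma)
  also have "\<dots> = (\<Sum>(u, v)\<in>hex_index N.
           coeff p (nat (int N - u - v)) * coeff q (nat (int N + u)) * coeff r (nat (int N + v)))"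
  proof (rule sum.reindex_bij_witness[where i = "\<lambda>(u, v). (nat (int N + u), nat (int N + v))"
          and j = "\<lambda>(i, j). (int i - int N, int j - int N)"], goal_cases)
    case (5 a)
    then obtain i j where a: "a = (i, j)" "i \<le> 3 * N" "j \<le> 3 * N - i"
      by auto
    then have "nat (int N - (int i - int N) - (int j - int N)) = 3 * N - i - j"
      by linarith
    then show ?case
      by (simp add: a mult_ac)
  qed (auto simp: hex_index_def)
  finally show ?thesis .
qed

text \<open>With n = (-u-v, u, v) this is (3/2)|n|^2 + n.(0, 1, 2), the Garvan-Kim-Stanton exponent
  for 3-cores.\<close>

definition cubic_form :: "int \<times> int \<Rightarrow> int" where
  "cubic_form = (\<lambda>(u, v). 3 * (u\<^sup>2 + u * v + v\<^sup>2) + u + 2 * v)"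

text \<open>With the same n this is |n|^2 - n_0, the exponent left by the progressions 2i, 2i+1,
  2i+1 once its constant part is removed.\<close>

definition even_form :: "int \<times> int \<Rightarrow> int" where
  "even_form = (\<lambda>(u, v). (u + v)\<^sup>2 + (u + v) + u\<^sup>2 + v\<^sup>2)"

lemma abs_le_quadratic: "\<bar>n\<bar> \<le> 3 * n\<^sup>2 + 2 * n" for n :: int
  using abs_le_square[of n] by (cases "n \<ge> 0") auto

text \<open>Twice the form is a sum of one-variable quadratics in u, v and u + v, each at least the
  absolute value of its variable up to a nonnegative term. Points of value below M thus have
  deviations below 2M, so N = 3M leaves a margin of M.\<close>

lemma cubic_form_bound:
  "\<bar>u\<bar> \<le> 2 * cubic_form (u, v)" "\<bar>v\<bar> \<le> 2 * cubic_form (u, v)" "\<bar>u + v\<bar> \<le> 2 * cubic_form (u, v)"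
proof -
  have "2 * cubic_form (u, v) = (3 * (u + v)\<^sup>2 + 2 * (u + v)) + 3 * u\<^sup>2 + (3 * v\<^sup>2 + 2 * v)"
    unfolding cubic_form_def by (simp add: power2_eq_square algebra_simps)
  note bounds = this abs_le_square[of u] abs_le_square[of v] abs_le_quadratic[of v] abs_le_quadratic[of "u + v"]
    abs_ge_zero[of u] abs_ge_zero[of v] abs_ge_zero[of "u + v"]
  show "\<bar>u\<bar> \<le> 2 * cubic_form (u, v)" using bounds by linarith
  show "\<bar>v\<bar> \<le> 2 * cubic_form (u, v)" using bounds by linarith
  show "\<bar>u + v\<bar> \<le> 2 * cubic_form (u, v)" using bounds by linarith
qed

lemma even_form_bound:
  "\<bar>u\<bar> \<le> even_form (u, v)" "\<bar>v\<bar> \<le> even_form (u, v)" "\<bar>u + v\<bar> \<le> 2 * even_form (u, v)"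
  unfolding even_form_def
  using abs_le_square[of u] abs_le_square[of v] abs_le_square[of "u + v"] by auto

lemma linprod_split3: "linprod 1 0 (3 * n) = linprod 3 0 n * linprod 3 1 n * linprod 3 2 n"
  unfolding linprod_def prod_lessThan_triple prod.distrib by simp

lemma linprod_split2: "linprod 1 0 (2 * n) = linprod 2 0 n * linprod 2 1 n"
  unfolding linprod_def prod_lessThan_double prod.distrib by simp

lemma double_int_cancel: "2 * int a = 2 * int b \<Longrightarrow> a = b"
  by simp

text \<open>Compare the coefficients of $z^{3N}$ in
  $\prod_{i<6N}(1+zq^i) = \prod_{j<3}\prod_{i<2N}(1+zq^{3i+j})$.\<close>

lemma cubic_theta_finite:
  "qbinom fps_X (6 * N) (3 * N) = (\<Sum>(u, v)\<in>hex_index N. fps_X ^ nat (cubic_form (u, v))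
      * (qbinom (fps_X ^ 3) (2 * N) (nat (int N - u - v)) * qbinom (fps_X ^ 3) (2 * N) (nat (int N + u))
          * qbinom (fps_X ^ 3) (2 * N) (nat (int N + v))) :: int fps)"
proof -
  have expo: "3 * (nat (int N - u - v) choose 2) + (3 * (nat (int N + u) choose 2) + nat (int N + u))
      + (3 * (nat (int N + v) choose 2) + 2 * nat (int N + v)) = (3 * N choose 2) + nat (cubic_form (u, v))"
    (is "?l = ?r") if "(u, v) \<in> hex_index N" for u v
  proof -
    have k: "int (nat (int N - u - v)) = int N - u - v" "int (nat (int N + u)) = int N + u"
      "int (nat (int N + v)) = int N + v"
      using that by (auto simp: hex_index_def)
    have "2 * int ?l = 3 * (2 * int (nat (int N - u - v) choose 2)) + 3 * (2 * int (nat (int N + u) choose 2))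
        + 2 * int (nat (int N + u)) + 3 * (2 * int (nat (int N + v) choose 2)) + 4 * int (nat (int N + v))"
      by simp
    also have "\<dots> = 2 * int (3 * N choose 2) + 2 * cubic_form (u, v)"
      unfolding two_choose_two k cubic_form_def by (simp add: power2_eq_square algebra_simps)
    also have "\<dots> = 2 * int ?r"
      using cubic_form_bound(1)[of u v] by simp
    finally show ?thesis by (rule double_int_cancel)
  qed
  have "fps_X ^ (3 * N choose 2) * qbinom fps_X (6 * N) (3 * N) = coeff (linprod 1 0 (3 * (2 * N))) (3 * N)"
    by (simp add: coeff_linprod)
  also have "\<dots> = (\<Sum>(u, v)\<in>hex_index N. fps_X ^ (3 * N choose 2) * (fps_X ^ nat (cubic_form (u, v))
      * (qbinom (fps_X ^ 3) (2 * N) (nat (int N - u - v)) * qbinom (fps_X ^ 3) (2 * N) (nat (int N + u))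
          * qbinom (fps_X ^ 3) (2 * N) (nat (int N + v)))))"
    unfolding linprod_split3 coeff_mult3_hex
  proof (intro sum.cong refl, clarify)
    fix u v assume "(u, v) \<in> hex_index N"
    from expo[OF this, symmetric]
    have X: "fps_X ^ (3 * N choose 2) * fps_X ^ nat (cubic_form (u, v)) =
        (fps_X ^ (3 * (nat (int N - u - v) choose 2)) * fps_X ^ (3 * (nat (int N + u) choose 2) + nat (int N + u))
         * fps_X ^ (3 * (nat (int N + v) choose 2) + 2 * nat (int N + v)) :: int fps)"
      by (simp only: power_add[symmetric])
    show "coeff (linprod 3 0 (2 * N)) (nat (int N - u - v)) * coeff (linprod 3 1 (2 * N)) (nat (int N + u))
          * coeff (linprod 3 2 (2 * N)) (nat (int N + v)) = fps_X ^ (3 * N choose 2) * (fps_X ^ nat (cubic_form (u, v))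
      * (qbinom (fps_X ^ 3) (2 * N) (nat (int N - u - v)) * qbinom (fps_X ^ 3) (2 * N) (nat (int N + u))
          * qbinom (fps_X ^ 3) (2 * N) (nat (int N + v))))"
      unfolding coeff_linprod mult_1 mult_zero_left add_0_right mult.assoc[symmetric] X by (simp only: mult_ac)
  qed
  finally show ?thesis
    by (simp add: case_prod_unfold flip: sum_distrib_left)
qed

text \<open>Let N grow in \<open>cubic_theta_finite\<close>: the binomial on the left tends to
  1/f_1, each of the three on the right to 1/f_3.\<close>

theorem cubic_theta_eq: "theta (\<lambda>_. 1) cubic_form * euler_f 1 = euler_f 3 ^ 3"
proof -
  let ?A = "theta (\<lambda>_. 1) cubic_form"
  have "eq_upto M (?A * euler_inv 3 ^ 3) (euler_inv 1)" for M
  proof -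
    define N where "N = 3 * M"
    let ?w = "\<lambda>(u, v). qbinom (fps_X ^ 3) (2 * N) (nat (int N - u - v)) * qbinom (fps_X ^ 3) (2 * N) (nat (int N + u))
          * qbinom (fps_X ^ 3) (2 * N) (nat (int N + v)) :: int fps"
    have "eq_upto M (\<Sum>z\<in>hex_index N. of_int 1 * fps_X ^ nat (cubic_form z) * ?w z) (?A * (euler_inv 3 * euler_inv 3 * euler_inv 3))"
    proof (rule eq_upto_theta[OF finite_hex_index])
      show "0 \<le> cubic_form z" for z
        using cubic_form_bound(1)[of "fst z" "snd z"] by simp
      show "z \<in> hex_index N" if "cubic_form z < int M" for z
        using that cubic_form_bound[where u = "fst z" and v = "snd z"] by (auto simp: hex_index_def N_def)
      show "eq_upto M (?w z) (euler_inv 3 * euler_inv 3 * euler_inv 3)" if "cubic_form z < int M" for z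
      proof -
        obtain u v where z: "z = (u, v)" by force
        have "int N - u - v = int N + (- u - v)" by simp
        note bounds = this that[unfolded z] cubic_form_bound[where u = u and v = v]
        show ?thesis
          unfolding z prod.case bounds(1)
          by (intro eq_upto_mult eq_upto_qbinom_central) (use bounds(2-) in \<open>auto simp: N_def\<close>)
      qed
    qed
    also have "(\<Sum>z\<in>hex_index N. of_int 1 * fps_X ^ nat (cubic_form z) * ?w z) = qbinom (fps_X ^ 1) (3 * N + 3 * N) (3 * N)"
      using cubic_theta_finite[of N] by (simp add: case_prod_unfold)
    finally have "eq_upto M (qbinom (fps_X ^ 1) (3 * N + 3 * N) (3 * N)) (?A * euler_inv 3 ^ 3)"
      by (simp only: power3_eq_cube)
    moreover have "eq_upto M (qbinom (fps_X ^ 1) (3 * N + 3 * N) (3 * N)) (euler_inv 1)"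
      by (rule eq_upto_qbinom) (auto simp: N_def)
    ultimately show ?thesis
      by (rule eq_upto_trans[OF eq_upto_sym])
  qed
  then have "?A * euler_inv 3 ^ 3 = euler_inv 1"
    by (rule eq_upto_imp_eq)
  then have "?A * euler_inv 3 ^ 3 * (euler_f 3 ^ 3 * euler_f 1) = euler_inv 1 * (euler_f 3 ^ 3 * euler_f 1)"
    by (rule arg_cong)
  then have "?A * (euler_f 3 * euler_inv 3) ^ 3 * euler_f 1 = euler_f 3 ^ 3 * (euler_f 1 * euler_inv 1)"
    by (simp only: power_mult_distrib mult_ac)
  then show ?thesis
    by (simp only: euler_f_mult_inv zero_less_numeral zero_less_one power_one mult_1_right)
qed

section \<open>The theta series of \<open>even_form\<close>\<close>

lemma coeff_mult_central:
  fixes p q :: "'a::comm_ring_1 poly"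
  shows "coeff (p * q) (3 * N) = (\<Sum>u\<in>{- int N..2 * int N}. coeff p (nat (2 * int N - u)) * coeff q (nat (int N + u)))"
proof -
  have "coeff (p * q) (3 * N) = (\<Sum>j\<le>3 * N. coeff q j * coeff p (3 * N - j))"
    by (simp add: coeff_mult mult.commute[of p])
  also have "\<dots> = (\<Sum>u\<in>{- int N..2 * int N}. coeff p (nat (2 * int N - u)) * coeff q (nat (int N + u)))"
  proof (rule sum.reindex_bij_witness[where i = "\<lambda>u. nat (int N + u)" and j = "\<lambda>j. int j - int N"], goal_cases)
    case (5 j)
    then have "nat (2 * int N - (int j - int N)) = 3 * N - j"
      by auto
    then show ?case
      by (simp add: mult.commute)
  qed auto
  finally show ?thesis .
qed

text \<open>Compute the coefficient of $z^{3N}$ in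
  $\prod_{i<2N}(1+zq^{2i})(1+zq^{2i+1})^2$ with and without merging the first two factors into
  $\prod_{i<4N}(1+zq^i)$.\<close>

lemma even_theta_finite:
  "(\<Sum>(u, v)\<in>hex_index N. fps_X ^ nat (even_form (u, v))
      * (qbinom (fps_X ^ 2) (2 * N) (nat (int N - u - v)) * qbinom (fps_X ^ 2) (2 * N) (nat (int N + u))
          * qbinom (fps_X ^ 2) (2 * N) (nat (int N + v))) :: int fps)
    = (\<Sum>u\<in>{- int N..2 * int N}. fps_X ^ nat (2 * tri u + tri (- u))
        * (qbinom fps_X (2 * (2 * N)) (nat (2 * int N - u)) * qbinom (fps_X ^ 2) (2 * N) (nat (int N + u))))"
    (is "?L = ?R")
proof -
  \<comment> \<open>The constant part of the exponent is 3N^2 - N; adding N on the left avoids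
    truncated subtraction.\<close>
  have expo: "2 * (nat (int N - u - v) choose 2) + (2 * (nat (int N + u) choose 2) + nat (int N + u))
      + (2 * (nat (int N + v) choose 2) + nat (int N + v)) + N = 3 * N * N + nat (even_form (u, v))"
    (is "?l = ?r") if "(u, v) \<in> hex_index N" for u v
  proof -
    have k: "int (nat (int N - u - v)) = int N - u - v" "int (nat (int N + u)) = int N + u"
      "int (nat (int N + v)) = int N + v"
      using that by (auto simp: hex_index_def)
    have "int ?l = (2 * int (nat (int N - u - v) choose 2)) + (2 * int (nat (int N + u) choose 2))
        + int (nat (int N + u)) + (2 * int (nat (int N + v) choose 2)) + int (nat (int N + v)) + int N"
      by simp
    also have "\<dots> = 3 * int N * int N + even_form (u, v)"
      unfolding two_choose_two k even_form_def by (simp add: power2_eq_square algebra_simps)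
    also have "\<dots> = int ?r"
      using even_form_bound(1)[of u v] by simp
    finally show ?thesis by (simp only: of_nat_eq_iff)
  qed
  have expo': "(nat (2 * int N - u) choose 2) + (2 * (nat (int N + u) choose 2) + nat (int N + u)) + N
      = 3 * N * N + nat (2 * tri u + tri (- u))"
    (is "?l = ?r") if "u \<in> {- int N..2 * int N}" for u
  proof -
    have k: "int (nat (2 * int N - u)) = 2 * int N - u" "int (nat (int N + u)) = int N + u"
      using that by auto
    have "2 * int ?l = (2 * int (nat (2 * int N - u) choose 2)) + 2 * (2 * int (nat (int N + u) choose 2))
        + 2 * int (nat (int N + u)) + 2 * int N"
      by simp
    also have "\<dots> = 6 * int N * int N + 2 * (2 * tri u) + 2 * tri (- u)"
      unfolding two_choose_two k two_tri by (simp add: power2_eq_square algebra_simps)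
    also have "\<dots> = 2 * int ?r"
      by (simp add: tri_nonneg)
    finally show ?thesis by (rule double_int_cancel)
  qed
  let ?P = "linprod 1 0 (2 * (2 * N)) * linprod 2 1 (2 * N)"
  have "fps_X ^ (3 * N * N) * ?L = fps_X ^ N * coeff ?P (3 * N)"
    unfolding linprod_split2 coeff_mult3_hex sum_distrib_left
  proof (intro sum.cong refl, clarify)
    fix u v assume "(u, v) \<in> hex_index N"
    from expo[OF this, symmetric]
    have X: "fps_X ^ (3 * N * N) * fps_X ^ nat (even_form (u, v)) =
        (fps_X ^ (2 * (nat (int N - u - v) choose 2)) * fps_X ^ (2 * (nat (int N + u) choose 2) + nat (int N + u))
         * fps_X ^ (2 * (nat (int N + v) choose 2) + nat (int N + v)) * fps_X ^ N :: int fps)"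
      by (simp only: power_add[symmetric])
    show "fps_X ^ (3 * N * N) * (fps_X ^ nat (even_form (u, v))
      * (qbinom (fps_X ^ 2) (2 * N) (nat (int N - u - v)) * qbinom (fps_X ^ 2) (2 * N) (nat (int N + u))
          * qbinom (fps_X ^ 2) (2 * N) (nat (int N + v)))) = fps_X ^ N * (coeff (linprod 2 0 (2 * N)) (nat (int N - u - v))
          * coeff (linprod 2 1 (2 * N)) (nat (int N + u)) * coeff (linprod 2 1 (2 * N)) (nat (int N + v)))"
      unfolding coeff_linprod mult_1 mult_zero_left add_0_right mult.assoc[symmetric] X by (simp only: mult_ac)
  qed
  also have "\<dots> = fps_X ^ (3 * N * N) * ?R"
    unfolding coeff_mult_central sum_distrib_left
  proof (intro sum.cong refl)
    fix u assume "u \<in> {- int N..2 * int N}"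
    from expo'[OF this, symmetric]
    have X: "fps_X ^ (3 * N * N) * fps_X ^ nat (2 * tri u + tri (- u)) =
        (fps_X ^ (nat (2 * int N - u) choose 2) * fps_X ^ (2 * (nat (int N + u) choose 2) + nat (int N + u)) * fps_X ^ N :: int fps)"
      by (simp only: power_add[symmetric])
    show "fps_X ^ N * (coeff (linprod 1 0 (2 * (2 * N))) (nat (2 * int N - u)) * coeff (linprod 2 1 (2 * N)) (nat (int N + u)))
       = fps_X ^ (3 * N * N) * (fps_X ^ nat (2 * tri u + tri (- u))
        * (qbinom fps_X (2 * (2 * N)) (nat (2 * int N - u)) * qbinom (fps_X ^ 2) (2 * N) (nat (int N + u))))"
      unfolding coeff_linprod mult_1 mult_zero_left add_0_right power_one_right mult.assoc[symmetric] X by (simp only: mult_ac)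
  qed
  finally show ?thesis
    by simp
qed

text \<open>The limit of \<open>even_theta_finite\<close>: three binomials tending to 1/f_2 on one
  side, one tending to 1/f_1 and one to 1/f_2 on the other.\<close>

lemma even_theta_rtheta: "theta (\<lambda>_. 1) even_form * euler_f 1 = rtheta 1 2 1 * euler_f 2 ^ 2"
proof -
  let ?E = "theta (\<lambda>_. 1) even_form"
  have "eq_upto M (?E * (euler_inv 2 * euler_inv 2 * euler_inv 2)) (rtheta 1 2 1 * (euler_inv 1 * euler_inv 2))" for M
  proof -
    define N where "N = 3 * M"
    let ?w = "\<lambda>(u, v). qbinom (fps_X ^ 2) (2 * N) (nat (int N - u - v)) * qbinom (fps_X ^ 2) (2 * N) (nat (int N + u))
          * qbinom (fps_X ^ 2) (2 * N) (nat (int N + v)) :: int fps"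
    \<comment> \<open>The merged progression has 4N factors, so its centre is 2N; its offset is -u
      because the powers of z add up to 3N.\<close>
    let ?w' = "\<lambda>u. qbinom (fps_X ^ 1) (2 * (2 * N)) (nat (int (2 * N) + - u)) * qbinom (fps_X ^ 2) (2 * N) (nat (int N + u)) :: int fps"
    have "eq_upto M (\<Sum>z\<in>hex_index N. of_int 1 * fps_X ^ nat (even_form z) * ?w z) (?E * (euler_inv 2 * euler_inv 2 * euler_inv 2))"
    proof (rule eq_upto_theta[OF finite_hex_index])
      show "0 \<le> even_form z" for z
        using even_form_bound(1)[of "fst z" "snd z"] by simp
      show "z \<in> hex_index N" if "even_form z < int M" for z
        using that even_form_bound[where u = "fst z" and v = "snd z"] by (auto simp: hex_index_def N_def)
      show "eq_upto M (?w z) (euler_inv 2 * euler_inv 2 * euler_inv 2)" if "even_form z < int M" for z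
      proof -
        obtain u v where z: "z = (u, v)" by force
        have "int N - u - v = int N + (- u - v)" by simp
        note bounds = this that[unfolded z] even_form_bound[where u = u and v = v]
        show ?thesis
          unfolding z prod.case bounds(1)
          by (intro eq_upto_mult eq_upto_qbinom_central) (use bounds(2-) in \<open>auto simp: N_def\<close>)
      qed
    qed
    also have "(\<Sum>z\<in>hex_index N. of_int 1 * fps_X ^ nat (even_form z) * ?w z)
        = (\<Sum>u\<in>{- int N..2 * int N}. of_int (1 ^ nat \<bar>u\<bar>) * fps_X ^ nat (int 2 * tri u + int 1 * tri (- u)) * ?w' u)"
      using even_theta_finite[of N] by (simp add: case_prod_unfold mult.assoc)
    finally have "eq_upto M (?E * (euler_inv 2 * euler_inv 2 * euler_inv 2)) \<dots>"
      by (rule eq_upto_sym)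
    also have "eq_upto M \<dots>
        (rtheta 1 2 1 * (euler_inv 1 * euler_inv 2))"
      unfolding rtheta_def
    proof (rule eq_upto_theta)
      have bound: "\<bar>u\<bar> \<le> int 2 * tri u + int 1 * tri (- u)" for u
        using two_tri[of u] two_tri[of "- u"] tri_nonneg[of u] abs_le_square[of u]
        by (simp add: power2_eq_square algebra_simps)
      show "0 \<le> int 2 * tri u + int 1 * tri (- u)" for u
        by (simp add: tri_nonneg)
      show "u \<in> {- int N..2 * int N}" if "int 2 * tri u + int 1 * tri (- u) < int M" for u
        using bound[of u] that by (auto simp: N_def)
      show "eq_upto M (?w' u) (euler_inv 1 * euler_inv 2)" if "int 2 * tri u + int 1 * tri (- u) < int M" for u
        using bound[of u] that by (intro eq_upto_mult eq_upto_qbinom_central) (auto simp: N_def)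
    qed simp
    finally show ?thesis .
  qed
  then have "?E * (euler_inv 2 * euler_inv 2 * euler_inv 2) = rtheta 1 2 1 * (euler_inv 1 * euler_inv 2)"
    by (rule eq_upto_imp_eq)
  then have "?E * (euler_inv 2 * euler_inv 2 * euler_inv 2) * (euler_f 2 * euler_f 2 * euler_f 2 * euler_f 1)
      = rtheta 1 2 1 * (euler_inv 1 * euler_inv 2) * (euler_f 2 * euler_f 2 * euler_f 2 * euler_f 1)"
    by (rule arg_cong)
  then have "?E * (euler_f 2 * euler_inv 2) * (euler_f 2 * euler_inv 2) * (euler_f 2 * euler_inv 2) * euler_f 1
      = rtheta 1 2 1 * euler_f 2 ^ 2 * (euler_f 1 * euler_inv 1) * (euler_f 2 * euler_inv 2)"
    by (simp only: power2_eq_square mult_ac)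
  then show ?thesis
    by (simp only: euler_f_mult_inv zero_less_numeral zero_less_one mult_1_right)
qed

theorem even_theta_eq: "theta (\<lambda>_. 1) even_form * euler_f 1 ^ 2 * euler_f 6 = euler_f 2 ^ 3 * euler_f 3 ^ 2"
proof -
  have "theta (\<lambda>_. 1) even_form * euler_f 1 ^ 2 * euler_f 6
      = (theta (\<lambda>_. 1) even_form * euler_f 1) * euler_f 1 * euler_f 6"
    by (simp only: power2_eq_square mult_ac)
  also have "\<dots> = (rtheta 1 2 1 * euler_f 1 * euler_f 6) * euler_f 2 ^ 2"
    unfolding even_theta_rtheta by (simp only: mult_ac)
  also have "\<dots> = euler_f 2 ^ 3 * euler_f 3 ^ 2"
    unfolding rtheta_2_1 by (simp only: power2_eq_square power3_eq_cube mult_ac)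
  finally show ?thesis .
qed

subsection \<open>Two-dissection of the 3-core series\<close>

lemma fps_nth_compose_X_power:
  fixes F :: "'a::comm_ring_1 fps"
  assumes "k > 0"
  shows "fps_nth (F oo fps_X ^ k) n = (if k dvd n then fps_nth F (n div k) else 0)"
proof -
  have "fps_nth (F oo fps_X ^ k) n = (\<Sum>i=0..n. if k * i = n then fps_nth F i else 0)"
    unfolding fps_compose_nth
    by (intro sum.cong refl) (auto simp flip: power_mult)
  also have "\<dots> = (if k dvd n then fps_nth F (n div k) else 0)"
  proof (cases "k dvd n")
    case True
    then obtain j where n: "n = k * j" by blast
    then have "(\<Sum>i=0..n. if k * i = n then fps_nth F i else 0) = (\<Sum>i\<in>{0..n}. if i = j then fps_nth F i else 0)"
      using assms by (intro sum.cong) auto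
    also have "\<dots> = fps_nth F j"
      using assms n by simp
    finally show ?thesis
      using assms n by simp
  qed (auto intro!: sum.neutral)
  finally show ?thesis .
qed

lemma X_power_nth_0: "k > 0 \<Longrightarrow> fps_nth (fps_X ^ k :: 'a::comm_ring_1 fps) 0 = 0"
  by simp

lemma compose_X_power_mult:
  "k > 0 \<Longrightarrow> (F * G) oo fps_X ^ k = (F oo fps_X ^ k) * (G oo fps_X ^ k)" for F G :: "int fps"
  by (rule fps_compose_mult_distrib[OF X_power_nth_0])

lemma compose_X_power_power:
  "k > 0 \<Longrightarrow> F ^ n oo fps_X ^ k = (F oo fps_X ^ k) ^ n" for F :: "int fps"
  by (rule fps_compose_power[OF X_power_nth_0, symmetric])

lemma X_power_compose: "k > 0 \<Longrightarrow> fps_X ^ m oo fps_X ^ k = (fps_X ^ (k * m) :: int fps)"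
  by (auto simp: fps_eq_iff fps_nth_compose_X_power)

lemma euler_f_compose:
  assumes "k > 0" "m > 0"
  shows "euler_f m oo fps_X ^ k = euler_f (k * m)"
proof (rule eq_upto_imp_eq)
  fix M
  have q: "qpoch (fps_X ^ m) n oo fps_X ^ k = (qpoch (fps_X ^ (k * m)) n :: int fps)" for n
    using assms
    by (induction n)
       (simp_all add: compose_X_power_mult fps_compose_sub_distrib X_power_compose mult.assoc distrib_left
          flip: power_mult power_Suc)
  have "eq_upto M (qpoch (fps_X ^ m) M oo fps_X ^ k) (euler_f m oo fps_X ^ k)"
    unfolding eq_upto_def
  proof (intro allI impI)
    fix i assume "i < M"
    then have "i div k < M"
      using div_le_dividend le_less_trans by blast
    then show "fps_nth (qpoch (fps_X ^ m) M oo fps_X ^ k) i = fps_nth (euler_f m oo fps_X ^ k) i"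
      using eq_upto_qpoch_euler_f[OF assms(2) order_refl, of M] assms(1)
      by (simp add: fps_nth_compose_X_power eq_upto_def)
  qed
  moreover have "eq_upto M (qpoch (fps_X ^ m) M oo fps_X ^ k) (euler_f (k * m))"
    unfolding q using assms by (intro eq_upto_qpoch_euler_f) auto
  ultimately show "eq_upto M (euler_f m oo fps_X ^ k) (euler_f (k * m))"
    by (rule eq_upto_trans[OF eq_upto_sym])
qed

text \<open>With Q the form, 3Q + 1 is the norm of 3u - (3v+1) \<omega>. The last identity is
  multiplication of this number by -2, which multiplies the norm by 4; the other three are the
  remaining parity classes, on which Q is even.\<close>

lemma cubic_form_even_even: "cubic_form (2 * s, 2 * t) = 2 * even_form (t - s, 2 * s + t)"
  and cubic_form_odd_even: "cubic_form (2 * s + 1, 2 * t) = 2 * even_form (2 * s + t + 1, - s - 2 * t - 1)"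
  and cubic_form_odd_odd: "cubic_form (2 * s + 1, 2 * t + 1) = 2 * even_form (- s - 2 * t - 2, t - s)"
  and cubic_form_even_odd: "cubic_form (- (2 * x), - (2 * y) - 1) = 4 * cubic_form (x, y) + 1"
  by (simp_all add: cubic_form_def even_form_def power2_eq_square algebra_simps)

text \<open>If $Q$ is the cubic form, $3Q+1$ is the norm of an Eisenstein integer $\alpha \equiv 1$
  modulo 3. If it is odd, then exactly one of $\alpha, \omega\alpha, \omega^2\alpha$ is $1$ modulo 2,
  and \<^const>\<open>even_form\<close> parametrises these; hence the three parity classes, matched with the
  residue of $u - v$ modulo 3.\<close>

definition halve :: "int \<times> int \<Rightarrow> int \<times> int" where
  "halve = (\<lambda>(x, y). let s = x div 2; t = y div 2 in
     if even x then (t - s, 2 * s + t)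
     else if even y then (2 * s + t + 1, - s - 2 * t - 1)
     else (- s - 2 * t - 2, t - s))"

text \<open>In the three branches of \<open>halve\<close> the difference u - v is 3(-s), 3(s+t) + 2
  and 3(-t-1) + 1; the remainder names the branch and w recovers the parameters.\<close>

definition unhalve :: "int \<times> int \<Rightarrow> int \<times> int" where
  "unhalve = (\<lambda>(u, v). let w = (u - v) div 3 in
     if (u - v) mod 3 = 0 then (- 2 * w, 2 * (u - w))
     else if (u - v) mod 3 = 2 then (2 * (u - w - 1) + 1, 2 * (2 * w - u + 1))
     else (2 * (- w - 1 - v) + 1, 2 * (- w - 1) + 1))"

lemma halve_simps:
  "halve (2 * s, 2 * t) = (t - s, 2 * s + t)"
  "halve (2 * s + 1, 2 * t) = (2 * s + t + 1, - s - 2 * t - 1)"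
  "halve (2 * s + 1, 2 * t + 1) = (- s - 2 * t - 2, t - s)"
  by (simp_all add: halve_def)

lemma unhalve_simps:
  "unhalve (t - s, 2 * s + t) = (2 * s, 2 * t)"
  "unhalve (2 * s + t + 1, - s - 2 * t - 1) = (2 * s + 1, 2 * t)"
  "unhalve (- s - 2 * t - 2, t - s) = (2 * s + 1, 2 * t + 1)"
proof -
  have 1: "t - s - (2 * s + t) = 3 * (- s)"
    and 2: "2 * s + t + 1 - (- s - 2 * t - 1) = 2 + 3 * (s + t)"
    and 3: "- s - 2 * t - 2 - (t - s) = 1 + 3 * (- t - 1)"
    by simp_all
  have "3 * (- s) div 3 = - s" "3 * (- s) mod 3 = 0"
    by presburger+
  then show "unhalve (t - s, 2 * s + t) = (2 * s, 2 * t)"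
    unfolding unhalve_def Let_def prod.case 1 by (simp only:) simp
  have "(2 + 3 * (s + t)) div 3 = s + t" "(2 + 3 * (s + t)) mod 3 = 2"
    by presburger+
  then show "unhalve (2 * s + t + 1, - s - 2 * t - 1) = (2 * s + 1, 2 * t)"
    unfolding unhalve_def Let_def prod.case 2 by simp
  have "(1 + 3 * (- t - 1)) div 3 = - t - 1" "(1 + 3 * (- t - 1)) mod 3 = 1"
    by presburger+
  then show "unhalve (- s - 2 * t - 2, t - s) = (2 * s + 1, 2 * t + 1)"
    unfolding unhalve_def Let_def prod.case 3 by simp
qed

text \<open>The even-odd class carries minus signs to match multiplication by -2 in
  \<open>cubic_form_even_odd\<close>.\<close>

lemma parity_cases:
  fixes z :: "int \<times> int"
  obtains s t where "z = (2 * s, 2 * t)" | s t where "z = (2 * s + 1, 2 * t)"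
  | s t where "z = (2 * s + 1, 2 * t + 1)" | s t where "z = (- (2 * s), - (2 * t) - 1)"
proof (cases z)
  case (Pair x y)
  have "x = 2 * (x div 2) \<or> x = 2 * (x div 2) + 1" "y = 2 * (y div 2) \<or> y = 2 * (y div 2) + 1"
    by presburger+
  moreover have "2 * (x div 2) = - (2 * (- (x div 2)))" "2 * (y div 2) + 1 = - (2 * (- (y div 2) - 1)) - 1"
    by simp_all
  ultimately show ?thesis
    using that Pair by metis
qed

lemma halve_unhalve: "halve (unhalve z) = z" "2 * even_form z = cubic_form (unhalve z)"
proof -
  obtain u v where z: "z = (u, v)" by force
  define w where "w = (u - v) div 3"
  have "v = u - 3 * w \<or> v = u - (3 * w + 2) \<or> v = u - (3 * w + 1)"
    unfolding w_def by presburger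
  then have "halve (unhalve z) = z \<and> 2 * even_form z = cubic_form (unhalve z)"
  proof (elim disjE)
    assume "v = u - 3 * w"
    \<comment> \<open>Each case puts z into the shape of one branch of \<open>halve\<close>, with s
      and t read off from \<open>unhalve\<close>.\<close>
    then have "z = ((u - w) - (- w), 2 * (- w) + (u - w))"
      using z by simp
    then show ?thesis
      by (simp only: unhalve_simps halve_simps cubic_form_even_even simp_thms)
  next
    assume "v = u - (3 * w + 2)"
    then have "z = (2 * (u - w - 1) + (2 * w - u + 1) + 1, - (u - w - 1) - 2 * (2 * w - u + 1) - 1)"
      using z by simp
    then show ?thesis
      by (simp only: unhalve_simps halve_simps cubic_form_odd_even simp_thms)
  next
    assume "v = u - (3 * w + 1)"
    then have "z = (- (- w - 1 - v) - 2 * (- w - 1) - 2, (- w - 1) - (- w - 1 - v))"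
      using z by simp
    then show ?thesis
      by (simp only: unhalve_simps halve_simps cubic_form_odd_odd simp_thms)
  qed
  then show "halve (unhalve z) = z" "2 * even_form z = cubic_form (unhalve z)"
    by auto
qed

lemma unhalve_halve:
  assumes "even (cubic_form z)"
  shows "unhalve (halve z) = z" "2 * even_form (halve z) = cubic_form z"
  using assms
  by (cases z rule: parity_cases;
      simp only: halve_simps unhalve_simps cubic_form_even_even cubic_form_odd_even cubic_form_odd_odd
        cubic_form_even_odd; simp)+

lemma cubic_form_odd_cases:
  assumes "odd (cubic_form z)"
  obtains x y where "z = (- (2 * x), - (2 * y) - 1)"
  using assms
  by (cases z rule: parity_cases)
     (simp_all only: cubic_form_even_even cubic_form_odd_even cubic_form_odd_odd, auto)

lemma cubic_theta_nth_even:
  "fps_nth (theta (\<lambda>_. 1) cubic_form) (2 * k) = fps_nth (theta (\<lambda>_. 1) even_form) k"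
  unfolding theta_def fps_nth_Abs_fps
proof (rule sum.reindex_bij_witness[where i = unhalve and j = halve], goal_cases)
  case (1 z)
  then show ?case using unhalve_halve(1)[of z] by simp
next
  case (2 z)
  then show ?case using unhalve_halve(2)[of z] by simp
next
  case (4 z)
  then show ?case using halve_unhalve(2)[of z] by simp
qed (simp_all add: halve_unhalve(1))

text \<open>Odd values occur only in the even-odd class, where they have the form 4Q + 1; that class
  is in bijection with the whole lattice, so 3 modulo 4 is never attained.\<close>

lemma cubic_theta_nth_odd:
  "fps_nth (theta (\<lambda>_. 1) cubic_form) (2 * k + 1)
     = (if even k then fps_nth (theta (\<lambda>_. 1) cubic_form) (k div 2) else 0)"
proof (cases "even k")
  case True
  then obtain j where k: "k = 2 * j" by blast
  let ?f = "\<lambda>(x, y). (- (2 * x), - (2 * y) - 1) :: int \<times> int"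
  have f: "cubic_form (?f z) = 4 * cubic_form z + 1" for z
    by (cases z) (simp only: prod.case cubic_form_even_odd)
  have "(\<Sum>z | cubic_form z = int (2 * k + 1). 1) = (\<Sum>z | cubic_form z = int j. 1 :: int)"
  proof (rule sum.reindex_bij_witness[where j = "\<lambda>(x, y). (- (x div 2), - ((y + 1) div 2))" and i = ?f], goal_cases)
    case (1 z)
    then have "odd (cubic_form z)" by simp
    then show ?case by (rule cubic_form_odd_cases) auto
  next
    case (2 z)
    then have "odd (cubic_form z)" by simp
    then obtain x y where "z = ?f (x, y)"
      by (rule cubic_form_odd_cases) auto
    moreover have "- (- (2 * x) div 2) = x" "- ((- (2 * y) - 1 + 1) div 2) = y"
      by presburger+
    ultimately have "(case z of (x, y) \<Rightarrow> (- (x div 2), - ((y + 1) div 2))) = (x, y)"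
      by (simp only: prod.case)
    moreover have "cubic_form (x, y) = int j"
      using 2 f[of "(x, y)"] \<open>z = ?f (x, y)\<close> unfolding k by simp
    ultimately show ?case by simp
  next
    case (4 z)
    then show ?case using f[of z] k by simp
  qed auto
  then show ?thesis
    using k by (simp add: theta_def)
next
  case False
  have "cubic_form z \<noteq> int (2 * k + 1)" for z
  proof
    assume z: "cubic_form z = int (2 * k + 1)"
    then have "odd (cubic_form z)" by simp
    then obtain x y where "z = (- (2 * x), - (2 * y) - 1)"
      by (rule cubic_form_odd_cases)
    then have "4 * cubic_form (x, y) + 1 = 2 * int k + 1"
      using z cubic_form_even_odd[of x y] by simp
    then have "int k = 2 * cubic_form (x, y)"
      by simp
    then have "even (int k)"
      by (metis dvd_triv_left)
    then show False
      using False by simp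
  qed
  then show ?thesis
    using False by (simp add: theta_def)
qed

subsection \<open>The congruence\<close>

definition core3_gf :: "int fps" where "core3_gf = theta (\<lambda>_. 1) cubic_form"
definition core3_even_gf :: "int fps" where "core3_even_gf = theta (\<lambda>_. 1) even_form"

theorem core3_gf_dissection: "core3_gf = (core3_even_gf oo fps_X ^ 2) + fps_X * (core3_gf oo fps_X ^ 4)"
proof (rule fps_ext)
  fix n :: nat
  consider k where "n = 2 * k" | k where "n = 2 * (2 * k) + 1" | k where "n = 2 * (2 * k + 1) + 1"
    by (metis evenE oddE)
  then show "fps_nth core3_gf n = fps_nth ((core3_even_gf oo fps_X ^ 2) + fps_X * (core3_gf oo fps_X ^ 4)) n"
  proof cases
    case 1
    have "\<not> 4 dvd 2 * k - Suc 0" if "k > 0" for k :: nat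
      using that by presburger
    then show ?thesis
      using 1 by (simp add: core3_gf_def core3_even_gf_def cubic_theta_nth_even fps_nth_compose_X_power fps_X_mult_nth)
  next
    case 2
    then show ?thesis
      using cubic_theta_nth_odd[of "2 * k"]
      by (simp add: core3_gf_def core3_even_gf_def fps_nth_compose_X_power)
  next
    case 3
    have "\<not> 4 dvd 4 * k + 2"
      by presburger
    then show ?thesis
      using 3 cubic_theta_nth_odd[of "2 * k + 1"]
      by (simp add: core3_gf_def core3_even_gf_def fps_nth_compose_X_power)
  qed
qed

section \<open>The generating function and its odd part\<close>

lemma core3_gf_mult: "core3_gf * euler_f 1 = euler_f 3 ^ 3"
  unfolding core3_gf_def by (rule cubic_theta_eq)

lemma core3_gf_compose_mult: "(core3_gf oo fps_X ^ 2) * euler_f 2 = euler_f 6 ^ 3"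
proof -
  have "(core3_gf oo fps_X ^ 2) * (euler_f 1 oo fps_X ^ 2) = (euler_f 3 oo fps_X ^ 2) ^ 3"
    using arg_cong[OF core3_gf_mult, of "\<lambda>F. F oo fps_X ^ 2"]
    by (simp only: compose_X_power_mult compose_X_power_power zero_less_numeral)
  then show ?thesis
    by (simp add: euler_f_compose del: One_nat_def)
qed

lemma cp3_gf_eq: "cp3_gf = core3_gf ^ 2 * (core3_gf oo fps_X ^ 2) ^ 2"
proof (rule cp3_gf_unique[symmetric])
  have "core3_gf ^ 2 * (core3_gf oo fps_X ^ 2) ^ 2 * (euler_f 1 ^ 2 * euler_f 2 ^ 2)
      = (core3_gf * euler_f 1) ^ 2 * ((core3_gf oo fps_X ^ 2) * euler_f 2) ^ 2"
    by (simp only: power_mult_distrib mult_ac)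
  also have "\<dots> = euler_f 3 ^ 6 * euler_f 6 ^ 6"
    unfolding core3_gf_mult core3_gf_compose_mult by (simp add: power_mult[symmetric])
  finally show "core3_gf ^ 2 * (core3_gf oo fps_X ^ 2) ^ 2 * (euler_f 1 ^ 2 * euler_f 2 ^ 2) = euler_f 3 ^ 6 * euler_f 6 ^ 6" .
qed

lemma fps_nth_numeral_mult: "fps_nth (numeral k * G) i = numeral k * fps_nth G i" for G :: "int fps"
  by (metis fps_mult_left_const_nth fps_numeral_fps_const)

definition cp3_half_gf :: "int fps" where "cp3_half_gf = core3_even_gf * core3_gf ^ 2 * (core3_gf oo fps_X ^ 2)"

text \<open>Square the dissection of A and multiply by A(q^2)^2: only the cross term has odd
  exponents, and it brings the factor 2.\<close>

lemma CP3_odd: "CP3 (2 * n + 1) = 2 * fps_nth cp3_half_gf n"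
proof -
  let ?A2 = "core3_gf oo fps_X ^ 2" and ?E2 = "core3_even_gf oo fps_X ^ 2" and ?A4 = "core3_gf oo fps_X ^ 4"
  have A4: "?A4 = ?A2 oo fps_X ^ 2"
    by (auto simp: fps_eq_iff fps_nth_compose_X_power elim!: dvdE)
  have "cp3_gf = (?E2 + fps_X * ?A4) ^ 2 * ?A2 ^ 2"
    unfolding cp3_gf_eq by (subst core3_gf_dissection) (rule refl)
  also have "\<dots> = ?E2 ^ 2 * ?A2 ^ 2 + fps_X ^ 2 * (?A4 ^ 2 * ?A2 ^ 2) + fps_X * (2 * (?E2 * ?A2 ^ 2 * ?A4))"
    by (simp add: power2_eq_square algebra_simps)
  also have "\<dots> = (core3_even_gf ^ 2 * core3_gf ^ 2 oo fps_X ^ 2) + fps_X ^ 2 * (?A2 ^ 2 * core3_gf ^ 2 oo fps_X ^ 2)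
      + fps_X * (2 * (cp3_half_gf oo fps_X ^ 2))"
    unfolding cp3_half_gf_def A4 by (simp only: compose_X_power_mult compose_X_power_power zero_less_numeral)
  finally have eq: "cp3_gf = \<dots>" .
  show ?thesis
    unfolding CP3_def eq by (auto simp: fps_nth_compose_X_power fps_X_power_mult_nth fps_nth_numeral_mult)
qed

section \<open>The series f_1^2 / f_2, classically phi(-q)\<close>

abbreviation "\<phi> \<equiv> rtheta (- 1) 1 1"

lemma phi_nth: "fps_nth \<phi> m = (\<Sum>u | u\<^sup>2 = int m. (- 1) ^ nat \<bar>u\<bar>)"
proof -
  have "int 1 * tri u + int 1 * tri (- u) = u\<^sup>2" for u
    using two_tri[of u] two_tri[of "- u"] by (simp add: power2_eq_square algebra_simps)
  then show ?thesis
    by (simp add: rtheta_def theta_def)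
qed

text \<open>For u nonzero, u and -u contribute equally, so s keeps one of each pair; its sign may be
  read from m = n^2, which has the parity of n.\<close>

lemma phi_decomp:
  obtains s where "\<phi> = 1 + 2 * s" "\<And>m. fps_nth s m \<noteq> 0 \<Longrightarrow> \<exists>n. m = n ^ 2"
proof
  define s where "s = Abs_fps (\<lambda>m. if \<exists>n>0. m = n ^ 2 then (- 1) ^ m else 0 :: int)"
  show "\<exists>n. m = n ^ 2" if "fps_nth s m \<noteq> 0" for m
    using that by (auto simp: s_def split: if_splits)
  show "\<phi> = 1 + 2 * s"
  proof (rule fps_ext)
    fix m :: nat
    consider "m = 0" | n where "n > 0" "m = n ^ 2" | "m \<noteq> 0" "\<nexists>n. n > 0 \<and> m = n ^ 2"
      by blast
    then show "fps_nth \<phi> m = fps_nth (1 + 2 * s) m"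
    proof cases
      case 1
      then show ?thesis unfolding phi_nth by (simp add: s_def fps_nth_numeral_mult)
    next
      case (2 n)
      have "{u. u\<^sup>2 = int m} = {int n, - int n}"
        using 2 by (auto simp: power2_eq_iff)
      then have "fps_nth \<phi> m = 2 * (- 1) ^ n"
        using 2 unfolding phi_nth by simp
      moreover have "(- 1) ^ m = ((- 1) ^ n :: int)"
        using 2 by (simp add: minus_one_power_iff)
      ultimately show ?thesis
        using 2 by (auto simp: s_def fps_nth_numeral_mult)
    next
      case 3
      have "u\<^sup>2 \<noteq> int m" for u
      proof
        assume "u\<^sup>2 = int m"
        then have "int m = int (nat \<bar>u\<bar> ^ 2)" by simp
        then have "m = nat \<bar>u\<bar> ^ 2" by (simp only: of_nat_eq_iff)
        moreover have "nat \<bar>u\<bar> > 0" using \<open>u\<^sup>2 = int m\<close> 3(1) by auto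
        ultimately show False using 3(2) by blast
      qed
      then have "{u. u\<^sup>2 = int m} = {}" by blast
      then show ?thesis
        using 3 unfolding phi_nth by (simp add: s_def fps_nth_numeral_mult)
    qed
  qed
qed

lemma phi_compose_mult:
  assumes "k > 0"
  shows "(\<phi> oo fps_X ^ k) * euler_f (2 * k) = euler_f k ^ 2"
proof -
  have "(\<phi> oo fps_X ^ k) * (euler_f 2 oo fps_X ^ k) = (euler_f 1 oo fps_X ^ k) ^ 2"
    using arg_cong[OF rtheta_1_1, of "\<lambda>F. F oo fps_X ^ k"] assms
    by (simp only: compose_X_power_mult compose_X_power_power)
  then show ?thesis
    using assms by (simp add: euler_f_compose mult.commute[of k 2] del: One_nat_def)
qed

lemma euler_f_nonzero: "m > 0 \<Longrightarrow> euler_f m \<noteq> 0"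
  using euler_f_has_prod(3)[of m] by force

lemma cp3_half_gf_mult: "cp3_half_gf * euler_f 1 ^ 4 = euler_f 2 ^ 2 * euler_f 3 ^ 8 * euler_f 6 ^ 2"
proof -
  have E: "core3_even_gf * euler_f 1 ^ 2 * euler_f 6 = euler_f 2 ^ 3 * euler_f 3 ^ 2"
    unfolding core3_even_gf_def by (rule even_theta_eq)
  have "(euler_f 2 * euler_f 6) * (cp3_half_gf * euler_f 1 ^ 4)
      = (core3_even_gf * euler_f 1 ^ 2 * euler_f 6) * (core3_gf * euler_f 1) ^ 2 * ((core3_gf oo fps_X ^ 2) * euler_f 2)"
    unfolding cp3_half_gf_def by (simp add: power2_eq_square power4_eq_xxxx mult_ac)
  also have "\<dots> = (euler_f 2 * euler_f 6) * (euler_f 2 ^ 2 * euler_f 3 ^ 8 * euler_f 6 ^ 2)"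
    unfolding E core3_gf_mult core3_gf_compose_mult by algebra
  finally show ?thesis
    by (rule mult_left_cancel[THEN iffD1, rotated]) (simp add: euler_f_nonzero)
qed

text \<open>Trade f_3^2 for phi(q^3) f_6, then f_6^2 for phi(q^6) f_12: f_3^8 f_6^2 = phi(q^3)^4
  f_6^6 = phi(q^3)^4 phi(q^6)^3 f_12^3.\<close>

lemma cp3_half_gf_phi:
  "cp3_half_gf * \<phi> ^ 2 = (\<phi> oo fps_X ^ 3) ^ 4 * ((\<phi> oo fps_X ^ 6) ^ 3 * euler_f 12 ^ 3)"
proof -
  have p3: "(\<phi> oo fps_X ^ 3) * euler_f 6 = euler_f 3 ^ 2"
    and p6: "(\<phi> oo fps_X ^ 6) * euler_f 12 = euler_f 6 ^ 2"
    using phi_compose_mult[of 3] phi_compose_mult[of 6] by simp_all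
  have "euler_f 2 ^ 2 * (cp3_half_gf * \<phi> ^ 2) = cp3_half_gf * (\<phi> * euler_f 2) ^ 2"
    by (simp only: power_mult_distrib mult_ac)
  also have "\<dots> = euler_f 2 ^ 2 * (euler_f 3 ^ 2) ^ 4 * euler_f 6 ^ 2"
    unfolding rtheta_1_1 using cp3_half_gf_mult by (simp flip: power_mult)
  also have "\<dots> = euler_f 2 ^ 2 * ((\<phi> oo fps_X ^ 3) ^ 4 * (euler_f 6 ^ 2) ^ 3)"
    unfolding p3[symmetric] by algebra
  also have "\<dots> = euler_f 2 ^ 2 * ((\<phi> oo fps_X ^ 3) ^ 4 * ((\<phi> oo fps_X ^ 6) ^ 3 * euler_f 12 ^ 3))"
    unfolding p6[symmetric] by (simp only: power_mult_distrib)
  finally show ?thesis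
    by (rule mult_left_cancel[THEN iffD1, rotated]) (simp add: euler_f_nonzero)
qed

text \<open>Pairing i with m - i cancels modulo 2 and leaves only a middle term: s^2 = s(q^2) modulo
  2.\<close>

lemma even_fps_nth_square:
  fixes s :: "int fps"
  assumes "\<And>i. m = 2 * i \<Longrightarrow> fps_nth s i = 0"
  shows "even (fps_nth (s ^ 2) m)"
proof -
  let ?g = "\<lambda>i. fps_nth s i * fps_nth s (m - i)"
  have "fps_nth (s ^ 2) m = (\<Sum>i\<in>{0..m}. ?g i)"
    by (simp add: power2_eq_square fps_mult_nth)
  also have "{0..m} = {i. 2 * i < m} \<union> {i. i \<le> m \<and> m < 2 * i} \<union> {i. m = 2 * i}"
    by auto
  also have "(\<Sum>i\<in>\<dots>. ?g i) = (\<Sum>i\<in>{i. 2 * i < m} \<union> {i. i \<le> m \<and> m < 2 * i}. ?g i) + (\<Sum>i | m = 2 * i. ?g i)"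
    by (rule sum.union_disjoint) (auto intro: finite_subset[of _ "{..m}"])
  also have "(\<Sum>i | m = 2 * i. ?g i) = 0"
    using assms by (intro sum.neutral) auto
  also have "(\<Sum>i\<in>{i. 2 * i < m} \<union> {i. i \<le> m \<and> m < 2 * i}. ?g i)
      = (\<Sum>i | 2 * i < m. ?g i) + (\<Sum>i | i \<le> m \<and> m < 2 * i. ?g i)"
    by (rule sum.union_disjoint) (auto intro: finite_subset[of _ "{..m}"])
  also have "(\<Sum>i | i \<le> m \<and> m < 2 * i. ?g i) = (\<Sum>i | 2 * i < m. ?g i)"
    by (rule sum.reindex_bij_witness[where i = "\<lambda>i. m - i" and j = "\<lambda>i. m - i"]) (auto simp: mult.commute)
  finally show ?thesis
    by simp
qed

lemma square_mod_12: "n\<^sup>2 mod 12 \<in> {0, 1, 4, 9}" for n :: nat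
proof -
  have "n mod 12 \<in> {0, 1, 2, 3, 4, 5, 6, 7, 8, 9, 10, 11}"
    unfolding insert_iff empty_iff by presburger
  then have "(n mod 12)\<^sup>2 mod 12 \<in> {0, 1, 4, 9}"
    by auto
  then show ?thesis
    by (simp only: power_mod)
qed

lemma eight_dvd_cp3_half_gf:
  assumes m: "m mod 12 = 7 \<or> m mod 12 = 10"
  shows "8 dvd fps_nth cp3_half_gf m"
proof -
  obtain s where s: "\<phi> = 1 + 2 * s" "\<And>i. fps_nth s i \<noteq> 0 \<Longrightarrow> \<exists>n. i = n ^ 2"
    using phi_decomp by blast
  define s3 where "s3 = s oo fps_X ^ 3"
  define s6 where "s6 = s oo fps_X ^ 6"
  have two: "(2 * s) oo G = 2 * (s oo G)" for G
    by (simp only: mult_2 fps_compose_add_distrib)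
  have \<phi>3: "\<phi> oo fps_X ^ 3 = 1 + 2 * s3" and \<phi>6: "\<phi> oo fps_X ^ 6 = 1 + 2 * s6"
    by (simp_all only: s(1) s3_def s6_def fps_compose_add_distrib two fps_compose_1)
  define w where "w = s + s\<^sup>2"
  define f where "f = euler_f 12 ^ 3"
  define F where "F = (\<phi> oo fps_X ^ 6) ^ 3 * euler_f 12 ^ 3"
  have H: "cp3_half_gf * (1 + 2 * s)\<^sup>2 = (1 + 2 * s3) ^ 4 * F"
    unfolding F_def \<phi>6 using cp3_half_gf_phi[unfolded \<phi>3 \<phi>6, unfolded s(1)] .
  have F: "F = (1 + 2 * s6) ^ 3 * f"
    unfolding F_def f_def \<phi>6 ..
  \<comment> \<open>$(1+2s)^4 = 1 + 8(w + 2w^2)$ and $(1+2s)^2 = 1 + 4w$, so multiplying by $(1+2s)^2$ once more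
    inverts it modulo 8\<close>
  have "cp3_half_gf = F + 4 * (f * w) + 8 * (- cp3_half_gf * (w + 2 * w\<^sup>2) + ((s3 + s3\<^sup>2) + 2 * (s3 + s3\<^sup>2)\<^sup>2) * F * (1 + 4 * w)
      + (3 * s6 + 6 * s6\<^sup>2 + 4 * s6 ^ 3) * f * w)"
    using H F unfolding w_def by algebra
  then obtain K where K: "cp3_half_gf = F + 4 * (f * w) + 8 * K"
    by blast
  \<comment> \<open>F is a series in q^3, while m is 1 modulo 3 in both cases.\<close>
  have "fps_nth F m = 0"
  proof -
    have "F = ((\<phi> oo fps_X ^ 2) ^ 3 * euler_f 4 ^ 3) oo fps_X ^ 3"
    proof -
      have "\<phi> oo fps_X ^ 6 = (\<phi> oo fps_X ^ 2) oo fps_X ^ 3"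
        by (auto simp: fps_eq_iff fps_nth_compose_X_power elim!: dvdE)
      then show ?thesis
        unfolding F_def
        by (simp add: compose_X_power_mult compose_X_power_power euler_f_compose)
    qed
    moreover have "\<not> 3 dvd m" using m by presburger
    ultimately show ?thesis
      by (simp add: fps_nth_compose_X_power)
  qed
  moreover have "even (fps_nth (f * w) m)"
    unfolding fps_mult_nth
  proof (rule dvd_sum)
    fix i assume i: "i \<in> {0..m}"
    \<comment> \<open>As a series in q^12, f leaves only the exponents m - i in the residue class of
      m modulo 12.\<close>
    have f: "f = euler_f 1 ^ 3 oo fps_X ^ 12"
      unfolding f_def by (simp add: compose_X_power_power euler_f_compose del: One_nat_def)
    show "even (fps_nth f i * fps_nth w (m - i))"
    proof (cases "12 dvd i")
      case True
      then obtain j where "i = 12 * j" by blast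
      then have "m = (m - i) + 12 * j" using i by simp
      then have k: "(m - i) mod 12 = 7 \<or> (m - i) mod 12 = 10"
        using m by (metis mod_mult_self2)
      \<comment> \<open>Neither 7 nor 10 is a square modulo 12.\<close>
      have s0: "fps_nth s (m - i) = 0"
      proof (rule ccontr)
        assume "fps_nth s (m - i) \<noteq> 0"
        then obtain n where "m - i = n ^ 2" using s(2) by blast
        then show False using k square_mod_12[of n] by auto
      qed
      \<comment> \<open>Twice a square is 0, 2, 6 or 8 modulo 12.\<close>
      have "even (fps_nth (s\<^sup>2) (m - i))"
      proof (rule even_fps_nth_square)
        fix l assume l: "m - i = 2 * l"
        show "fps_nth s l = 0"
        proof (rule ccontr)
          assume "fps_nth s l \<noteq> 0"
          then obtain n where "l = n ^ 2" using s(2) by blast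
          moreover have "2 * l mod 12 = 2 * (l mod 12) mod 12"
            by (simp only: mod_mult_right_eq)
          ultimately show False
            using k square_mod_12[of n] unfolding l by auto
        qed
      qed
      then show ?thesis
        by (simp add: w_def s0)
    next
      case False
      then show ?thesis by (simp add: f fps_nth_compose_X_power)
    qed
  qed
  ultimately show ?thesis
    unfolding K by (auto simp: fps_nth_numeral_mult)
qed

theorem theorem3p7:
  fixes n :: nat
  shows "[CP3 (24 * n + 15) = 0] (mod 16) \<and> [CP3 (24 * n + 21) = 0] (mod 16)"
proof -
  \<comment> \<open>24n + 15 = 2(12n + 7) + 1 and 24n + 21 = 2(12n + 10) + 1; the factor 2 of
    \<open>CP3_odd\<close> lifts 8 to 16.\<close>
  have "16 dvd CP3 (2 * m + 1)" if "m mod 12 = 7 \<or> m mod 12 = 10" for m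
    using eight_dvd_cp3_half_gf[OF that] unfolding CP3_odd by auto
  from this[of "12 * n + 7"] this[of "12 * n + 10"] show ?thesis
    by (simp add: cong_0_iff add.commute)
qed

end
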